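(* Let $G$ be an abelian, second countable, locally compact group with Haar measure $\mu$. Assume that there exists a F\o lner sequence $(\Lambda_n)$ in $G$ satisfying the Tempelman condition (i.e. there is a real $c>0$ with $\mu(\Lambda_n^{-1}\Lambda_n)\le c\,\mu(\Lambda_n)$ for all $n\in\mathbb{N}$) and such that $(\Lambda_n^{-1}\Lambda_n)$ is also a F\o lner sequence in $G$. Let $M\subset \mathrm{Hom}(G)$ be translational. Let $(A,\omega,\tau,G)$ be a C*-dynamical system which is $M$-weakly mixing relative to $(\Lambda_n)$ and $M$-asymptotically abelian relative to $(\Lambda_n)$. Assume furthermore that $G\to A: g\mapsto \tau_{\varphi(g)}(a)$ is continuous in the norm topology of $A$ for all $\varphi\in M$ and all $a\in A$. Then \[ \lim_{n\to\infty}\frac{1}{\mu(\Lambda_n)}\int_{\Lambda_n}\left|\omega\left(\prod_{j=0}^{k}\tau_{\varphi_j(g)}(a_j)\right)-\prod_{j=0}^{k}\omega(a_j)\right|dg=0 \] for every $k\in\mathbb{N}$, all $a_0,\dots,a_k\in A$, and all $\varphi_1,\dots,\varphi_k\in M$ with $\varphi_j\ne\varphi_l$ whenever $j\ne l$, $j,l\in\{1,\dots,k\}$, where $\varphi_0(g)=e$ for all $g\in G$.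
   Context: The group $G$ is written multiplicatively with identity $e$; $\mathrm{Hom}(G)$ is the set of all group homomorphisms $G\to G$. For sets $V,W\subset G$, $VW=\{vw:v\in V,w\in W\}$, $V^{-1}=\{v^{-1}:v\in V\}$, $Vg=\{vg:v\in V\}$. A F\o lner sequence in $G$ is a sequence $(\Lambda_n)$ of compact subsets of $G$ with $\mu(\Lambda_n)>0$ for all $n$ and $\lim_{n}\mu(\Lambda_n\,\Delta\,(\Lambda_n g))/\mu(\Lambda_n)=0$ for all $g\in G$. A C*-dynamical system $(A,\omega,\tau,G)$ consists of a unital C*-algebra $A$, a state $\omega$ on $A$, and $*$-automorphisms $\tau_g$ of $A$ ($g\in G$) with $\tau_g\circ\tau_h=\tau_{gh}$, $\tau_e=\mathrm{id}_A$, $g\mapsto\omega(a\tau_g(b))$ Borel measurable for all $a,b\in A$, and $\omega\circ\tau_g=\omega$ for all $g$. For $M\subset\mathrm{Hom}(G)$ such that $g\mapsto\omega(a\tau_{\varphi(g)}(b))$ is Borel measurable for all $a,b\in A$, $\varphi\in M$: the system is $M$-weakly mixing relative to $(\Lambda_n)$ if $\lim_n\frac{1}{\mu(\Lambda_n)}\int_{\Lambda_n}|\omega(a\tau_{\varphi(g)}(b))-\omega(a)\omega(b)|\,dg=0$ for all $a,b\in A$, $\varphi\in M$. The system is $M$-asymptotically abelian relative to $(\Lambda_n)$ if $g\mapsto\tau_{\varphi(g)}(b)$ is continuous and $\lim_n\frac{1}{\mu(\Lambda_n)}\int_{\Lambda_n}\|[a,\tau_{\varphi(g)}(b)]\|\,dg=0$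 for all $a,b\in A$, $\varphi\in M$, where $[a,b]=ab-ba$. A set $M\subset\mathrm{Hom}(G)$ is translational if for all $\varphi_1,\varphi_2\in M$ with $\varphi_1\neq\varphi_2$, the homomorphism $g\mapsto\varphi_2(g)^{-1}\varphi_1(g)$ also lies in $M$. The product $\prod_{j=0}^{k}b_j$ denotes $b_0b_1\cdots b_k$ in this order. *)

theory Defs
  imports "HOL-Analysis.Analysis"
begin

text \<open>The group G is a type of class topological_ab_group_add (written additively:
  e = 0, g h = g + h, g^-1 = -g), Hausdorff, second countable; local compactness is
  stated for the type's topology.\<close>

definition haar_measure :: "'g::{topological_ab_group_add} measure \<Rightarrow> bool" where
  "haar_measure \<mu> \<longleftrightarrow>
     sets \<mu> = sets borel \<and>
     (\<forall>A \<in> sets borel. \<forall>g. emeasure \<mu> ((\<lambda>x. g + x) ` A) = emeasure \<mu> A) \<and>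
     (\<forall>K. compact K \<longrightarrow> emeasure \<mu> K < \<infinity>) \<and>
     (\<forall>U. open U \<and> U \<noteq> {} \<longrightarrow> 0 < emeasure \<mu> U) \<and>
     (\<forall>A \<in> sets borel. emeasure \<mu> A = (INF U \<in> {U. open U \<and> A \<subseteq> U}. emeasure \<mu> U)) \<and>
     (\<forall>U. open U \<longrightarrow> emeasure \<mu> U = (SUP K \<in> {K. compact K \<and> K \<subseteq> U}. emeasure \<mu> K))"

definition group_hom :: "('g::ab_group_add \<Rightarrow> 'g) \<Rightarrow> bool" where
  "group_hom \<phi> \<longleftrightarrow> (\<forall>x y. \<phi> (x + y) = \<phi> x + \<phi> y)"

definition translational :: "('g::ab_group_add \<Rightarrow> 'g) set \<Rightarrow> bool" where
  "translational M \<longleftrightarrow>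
     (\<forall>\<phi>1 \<in> M. \<forall>\<phi>2 \<in> M. \<phi>1 \<noteq> \<phi>2 \<longrightarrow> (\<lambda>g. - \<phi>2 g + \<phi>1 g) \<in> M)"

definition rtrans :: "'g::ab_group_add set \<Rightarrow> 'g \<Rightarrow> 'g set" where
  "rtrans V g = (\<lambda>v. v + g) ` V"

definition inv_mult_set :: "'g::ab_group_add set \<Rightarrow> 'g set \<Rightarrow> 'g set" where
  "inv_mult_set V W = {- v + w | v w. v \<in> V \<and> w \<in> W}"

definition folner_seq :: "'g::topological_ab_group_add measure \<Rightarrow> (nat \<Rightarrow> 'g set) \<Rightarrow> bool" where
  "folner_seq \<mu> \<Lambda> \<longleftrightarrow>
     (\<forall>n. compact (\<Lambda> n) \<and> 0 < emeasure \<mu> (\<Lambda> n)) \<and>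
     (\<forall>g. (\<lambda>n. measure \<mu> ((\<Lambda> n - rtrans (\<Lambda> n) g) \<union> (rtrans (\<Lambda> n) g - \<Lambda> n))
                / measure \<mu> (\<Lambda> n)) \<longlonglongrightarrow> 0)"

definition tempelman :: "'g::topological_ab_group_add measure \<Rightarrow> (nat \<Rightarrow> 'g set) \<Rightarrow> bool" where
  "tempelman \<mu> \<Lambda> \<longleftrightarrow>
     (\<exists>c::real. c > 0 \<and> (\<forall>n. measure \<mu> (inv_mult_set (\<Lambda> n) (\<Lambda> n)) \<le> c * measure \<mu> (\<Lambda> n)))"

definition favg :: "'g measure \<Rightarrow> 'g set \<Rightarrow> ('g \<Rightarrow> real) \<Rightarrow> real" where
  "favg \<mu> L f = (1 / measure \<mu> L) * (LINT g:L|\<mu>. f g)"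

text \<open>A unital complex Banach algebra is encoded as a real unital Banach algebra
  (type class real_normed_algebra_1 + banach) together with a central element j
  (playing the role of the complex unit i * 1) with j * j = -1, such that the induced
  complex scalar multiplication (x + i y) a = x a + y (j a) is compatible with the
  norm. The involution is an explicit map star.\<close>

definition cscale :: "'a::real_normed_algebra_1 \<Rightarrow> complex \<Rightarrow> 'a \<Rightarrow> 'a" where
  "cscale j c a = scaleR (Re c) a + scaleR (Im c) (j * a)"

definition unital_cstar_algebra ::
  "'a::{real_normed_algebra_1, banach} \<Rightarrow> ('a \<Rightarrow> 'a) \<Rightarrow> bool" where
  "unital_cstar_algebra j star \<longleftrightarrow>
     (\<forall>a. j * a = a * j) \<and> j * j = - 1 \<and>
     (\<forall>c a. norm (cscale j c a) = cmod c * norm a) \<and>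
     (\<forall>a. star (star a) = a) \<and>
     (\<forall>a b. star (a + b) = star a + star b) \<and>
     (\<forall>c a. star (cscale j c a) = cscale j (cnj c) (star a)) \<and>
     (\<forall>a b. star (a * b) = star b * star a) \<and>
     (\<forall>a. norm (star a * a) = (norm a)\<^sup>2)"

definition is_state ::
  "'a::{real_normed_algebra_1, banach} \<Rightarrow> ('a \<Rightarrow> 'a) \<Rightarrow> ('a \<Rightarrow> complex) \<Rightarrow> bool" where
  "is_state j star \<omega> \<longleftrightarrow>
     (\<forall>a b. \<omega> (a + b) = \<omega> a + \<omega> b) \<and>
     (\<forall>c a. \<omega> (cscale j c a) = c * \<omega> a) \<and>
     (\<forall>a. Im (\<omega> (star a * a)) = 0 \<and> 0 \<le> Re (\<omega> (star a * a))) \<and>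
     \<omega> 1 = 1"

definition star_automorphism ::
  "'a::{real_normed_algebra_1, banach} \<Rightarrow> ('a \<Rightarrow> 'a) \<Rightarrow> ('a \<Rightarrow> 'a) \<Rightarrow> bool" where
  "star_automorphism j star T \<longleftrightarrow>
     bij T \<and>
     (\<forall>a b. T (a + b) = T a + T b) \<and>
     (\<forall>c a. T (cscale j c a) = cscale j c (T a)) \<and>
     (\<forall>a b. T (a * b) = T a * T b) \<and>
     (\<forall>a. T (star a) = star (T a))"

definition cstar_dyn_system ::
  "'a::{real_normed_algebra_1, banach} \<Rightarrow> ('a \<Rightarrow> 'a) \<Rightarrow> ('a \<Rightarrow> complex)
   \<Rightarrow> ('g::topological_ab_group_add \<Rightarrow> 'a \<Rightarrow> 'a) \<Rightarrow> bool" where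
  "cstar_dyn_system j star \<omega> \<tau> \<longleftrightarrow>
     unital_cstar_algebra j star \<and> is_state j star \<omega> \<and>
     (\<forall>g. star_automorphism j star (\<tau> g)) \<and>
     (\<forall>g h. \<tau> g \<circ> \<tau> h = \<tau> (g + h)) \<and> \<tau> 0 = id \<and>
     (\<forall>a b. (\<lambda>g. \<omega> (a * \<tau> g b)) \<in> borel_measurable borel) \<and>
     (\<forall>g a. \<omega> (\<tau> g a) = \<omega> a)"

definition M_measurable ::
  "('a::{real_normed_algebra_1, banach} \<Rightarrow> complex) \<Rightarrow> ('g::topological_ab_group_add \<Rightarrow> 'a \<Rightarrow> 'a)
   \<Rightarrow> ('g \<Rightarrow> 'g) set \<Rightarrow> bool" where
  "M_measurable \<omega> \<tau> M \<longleftrightarrow>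
     (\<forall>\<phi> \<in> M. \<forall>a b. (\<lambda>g. \<omega> (a * \<tau> (\<phi> g) b)) \<in> borel_measurable borel)"

definition M_weakly_mixing ::
  "'g::topological_ab_group_add measure \<Rightarrow> ('a::{real_normed_algebra_1, banach} \<Rightarrow> complex)
   \<Rightarrow> ('g \<Rightarrow> 'a \<Rightarrow> 'a) \<Rightarrow> ('g \<Rightarrow> 'g) set \<Rightarrow> (nat \<Rightarrow> 'g set) \<Rightarrow> bool" where
  "M_weakly_mixing \<mu> \<omega> \<tau> M \<Lambda> \<longleftrightarrow>
     (\<forall>a b. \<forall>\<phi> \<in> M.
        (\<lambda>n. favg \<mu> (\<Lambda> n) (\<lambda>g. cmod (\<omega> (a * \<tau> (\<phi> g) b) - \<omega> a * \<omega> b))) \<longlonglongrightarrow> 0)"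

definition M_asymptotically_abelian ::
  "'g::topological_ab_group_add measure \<Rightarrow> ('g \<Rightarrow> 'a::{real_normed_algebra_1, banach} \<Rightarrow> 'a)
   \<Rightarrow> ('g \<Rightarrow> 'g) set \<Rightarrow> (nat \<Rightarrow> 'g set) \<Rightarrow> bool" where
  "M_asymptotically_abelian \<mu> \<tau> M \<Lambda> \<longleftrightarrow>
     (\<forall>a b. \<forall>\<phi> \<in> M.
        continuous_on UNIV (\<lambda>g. \<tau> (\<phi> g) b) \<and>
        (\<lambda>n. favg \<mu> (\<Lambda> n) (\<lambda>g. norm (a * \<tau> (\<phi> g) b - \<tau> (\<phi> g) b * a))) \<longlonglongrightarrow> 0)"

end

theory Submission
  imports Defs
begin

text \<open>
  Fix distinct \<open>\<phi>\<^sub>1, \<dots>, \<phi>\<^sub>k \<in> M\<close>, let \<open>U\<^sub>g\<close> be the ordered product of the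
  \<open>\<tau> (\<phi>\<^sub>i g) a\<^sub>i\<close> with \<open>i \<ge> 1\<close>, and let \<open>c\<close> be the product of the \<open>\<omega> a\<^sub>i\<close>. The claim is
  that \<open>\<bar>\<omega> (a\<^sub>0 v\<^sub>g)\<bar>\<close> has vanishing averages, where \<open>v\<^sub>g = U\<^sub>g - c\<close>. Finitely many shifts
  \<open>h\<^sub>1, \<dots>, h\<^sub>N\<close> do not change the averages asymptotically, and for each fixed \<open>g\<close> a
  Boas--Bellman inequality for the semi-inner product \<open>\<omega> (x\<^sup>* y)\<close> bounds
  \<open>\<Sum>\<^sub>i \<bar>\<omega> (a\<^sub>0 v\<^bsub>g + h\<^sub>i\<^esub>)\<bar>\<^sup>2\<close> by a constant plus the off-diagonal correlations
  \<open>\<bar>\<omega> (v\<^bsub>g + h\<^sub>i\<^esub>\<^sup>* v\<^bsub>g + h\<^sub>k\<^esub>)\<bar>\<close>. Asymptotic abelianness rearranges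
  \<open>U\<^sub>g\<^sup>* U\<^bsub>g + h\<^esub>\<close> into the ordered product of the \<open>\<tau> (\<phi>\<^sub>i g) (a\<^sub>i\<^sup>* \<tau> (\<phi>\<^sub>i h) a\<^sub>i)\<close>. By invariance of
  \<open>\<omega>\<close> under \<open>\<tau> (- \<phi>\<^sub>1 g)\<close> its expectation involves only the \<open>k - 1\<close> homomorphisms
  \<open>\<phi>\<^sub>i - \<phi>\<^sub>1 \<in> M\<close>, so by induction the correlations average in \<open>g\<close> to a function of \<open>h\<close> which weak
  mixing makes null. Hence the shifts can be chosen one after the other so that all
  off-diagonal correlations are small; dividing by \<open>N\<close> gives the result.
\<close>

section \<open>States and automorphisms of C*-algebras\<close>

locale cstar_algebra =
  fixes j :: "'a::{real_normed_algebra_1, banach}" and star :: "'a \<Rightarrow> 'a"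
  assumes cstar: "unital_cstar_algebra j star"
begin

lemma j_commute: "a * j = j * a"
  using cstar unfolding unital_cstar_algebra_def by metis

lemma j_square: "j * j = - 1"
  using cstar unfolding unital_cstar_algebra_def by metis

lemma j_square_mult: "j * (j * a) = - a"
  by (simp add: j_square flip: mult.assoc)

lemma j_left_commute: "a * (j * b) = j * (a * b)"
  by (metis j_commute mult.assoc)

lemma star_star: "star (star a) = a"
  using cstar unfolding unital_cstar_algebra_def by metis

lemma star_add: "star (a + b) = star a + star b"
  using cstar unfolding unital_cstar_algebra_def by metis

lemma star_mult: "star (a * b) = star b * star a"
  using cstar unfolding unital_cstar_algebra_def by metis

lemma star_cscale: "star (cscale j c a) = cscale j (cnj c) (star a)"
  using cstar unfolding unital_cstar_algebra_def by metis

lemma norm_star_mult_self: "norm (star a * a) = (norm a)\<^sup>2"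
  using cstar unfolding unital_cstar_algebra_def by metis

lemma norm_cscale: "norm (cscale j c a) = cmod c * norm a"
  using cstar unfolding unital_cstar_algebra_def by metis

lemma cscale_of_real: "cscale j (of_real r) a = r *\<^sub>R a"
  by (simp add: cscale_def)

lemma cscale_ii: "cscale j \<i> a = j * a"
  by (simp add: cscale_def)

lemma star_scaleR: "star (r *\<^sub>R a) = r *\<^sub>R star a"
  using star_cscale[of "of_real r" a] by (simp add: cscale_of_real)

lemma star_j_mult: "star (j * a) = - (j * star a)"
  using star_cscale[of \<i> a] by (simp add: cscale_def)

lemma star_minus: "star (- a) = - star a"
  using star_scaleR[of "-1" a] by simp

lemma star_diff: "star (a - b) = star a - star b"
  using star_add[of a "- b"] by (simp add: star_minus)

lemma star_one: "star 1 = 1"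
  by (metis star_mult star_star mult_1)

lemma norm_star: "norm (star a) = norm a"
proof -
  have le: "norm b \<le> norm (star b)" for b
  proof (cases "norm b = 0")
    case False
    have "norm b * norm b \<le> norm (star b) * norm b"
      using norm_mult_ineq[of "star b" b] by (simp add: norm_star_mult_self power2_eq_square)
    with False show ?thesis by simp
  qed simp
  show ?thesis using le[of a] le[of "star a"] by (simp add: star_star)
qed

lemma bounded_linear_star: "bounded_linear star"
  by (rule bounded_linear_intro[of _ 1]) (simp_all add: star_add star_scaleR norm_star)

text \<open>The fixed point \<open>y\<close> of \<open>y \<mapsto> (p + y\<^sup>2) / 2\<close> satisfies \<open>(1 - y)\<^sup>2 = 1 - p\<close>.\<close>

lemma selfadjoint_sqrt_exists:
  assumes p: "star p = p" and le: "norm p \<le> 3/4" and comm: "h * p = p * h"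
  obtains w where "star w = w" "w * w = 1 - p" "h * w = w * h"
proof -
  \<comment> \<open>Self-adjointness and commutation with \<open>h\<close> are closed conditions
    preserved by \<open>F\<close>, so the fixed point inherits them. Radius 1/2 gives invariance, as
    (3/4 + 1/4) / 2 = 1/2, and also contraction constant 1/2.\<close>
  define S where "S = {y. star y = y} \<inter> {y. h * y = y * h} \<inter> cball 0 (1/2)"
  define F where "F = (\<lambda>y. (1/2) *\<^sub>R (p + y * y))"
  have cs: "continuous_on UNIV star"
    by (rule bounded_linear.continuous_on[OF bounded_linear_star continuous_on_id])
  have "closed {y. star y = y}" "closed {y. h * y = y * h}"
    by (rule closed_Collect_eq; intro cs continuous_intros)+
  then have "closed S" unfolding S_def by blast
  then have cS: "complete S" by (simp add: complete_eq_closed)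
  have "star 0 = 0" using star_diff[of 0 0] by simp
  then have ne: "S \<noteq> {}" unfolding S_def by (auto intro: exI[of _ 0])
  have sub: "F ` S \<subseteq> S"
  proof
    fix z assume "z \<in> F ` S"
    then obtain y where y: "star y = y" "h * y = y * h" "norm y \<le> 1/2" "z = F y"
      by (auto simp: S_def)
    have "norm (y * y) \<le> (1/2) * (1/2)"
      using y(3) norm_mult_ineq[of y y] mult_mono[of "norm y" "1/2" "norm y" "1/2"] by simp
    then have "norm z \<le> 1/2"
      using le norm_triangle_ineq[of p "y * y"] by (simp add: y(4) F_def)
    moreover have "star z = z" by (simp add: y F_def star_scaleR star_add star_mult p)
    moreover have "h * (y * y) = y * y * h" by (metis y(2) mult.assoc)
    then have "h * z = z * h" by (simp add: y(4) F_def comm distrib_left distrib_right)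
    ultimately show "z \<in> S" by (simp add: S_def)
  qed
  have contr: "dist (F x) (F y) \<le> (1/2) * dist x y" if "x \<in> S" "y \<in> S" for x y
  proof -
    have n: "norm x \<le> 1/2" "norm y \<le> 1/2" using that by (auto simp: S_def)
    have "F x - F y = (1/2) *\<^sub>R (x * (x - y) + (x - y) * y)"
      by (simp add: F_def algebra_simps)
    then have "norm (F x - F y) \<le> (1/2) * (norm x * norm (x - y) + norm (x - y) * norm y)"
      using norm_triangle_ineq[of "x * (x - y)" "(x - y) * y"] norm_mult_ineq[of x "x - y"]
        norm_mult_ineq[of "x - y" y] by simp
    also have "\<dots> \<le> (1/2) * ((1/2) * norm (x - y) + norm (x - y) * (1/2))"
      using n by (intro mult_left_mono add_mono mult_right_mono) auto
    finally show ?thesis by (simp add: dist_norm)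
  qed
  obtain y where y: "y \<in> S" "F y = y"
    using Banach_fix[OF cS ne _ _ sub, of "1/2"] contr by auto
  have "(2::real) *\<^sub>R F y = p + y * y" by (simp add: F_def)
  then have "p + y * y = y + y" using y(2) by (simp add: scaleR_2)
  then have "(1 - y) * (1 - y) = 1 - p" by (simp add: algebra_simps)
  moreover have "star (1 - y) = 1 - y" "h * (1 - y) = (1 - y) * h"
    using y(1) by (auto simp: S_def star_diff star_one algebra_simps)
  ultimately show ?thesis using that by blast
qed

text \<open>Take z = h + i w with w a self-adjoint square root of 1 - h^2 that commutes with
  \<open>h\<close>: the cross terms cancel and star z * z = h^2 + w^2 = 1. This gives bounds for
  automorphisms and states without spectral theory.\<close>

lemma selfadjoint_average_of_unitary:
  assumes h: "star h = h" and le: "norm h \<le> 3/4"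
  obtains z where "star z * z = 1" "h = (1/2) *\<^sub>R (z + star z)"
proof -
  have "norm (h * h) \<le> 1 * (3/4)"
    using norm_mult_ineq[of h h] mult_mono[of "norm h" 1 "norm h" "3/4"] le by simp
  then obtain w where w: "star w = w" "w * w = 1 - h * h" "h * w = w * h"
    using selfadjoint_sqrt_exists[of "h * h" h] h by (auto simp: star_mult mult.assoc)
  have s: "star (h + j * w) = h - j * w" by (simp add: star_add star_j_mult w h)
  have "j * w * (j * w) = - (w * w)"
    by (metis j_left_commute j_square_mult mult.assoc)
  moreover have "j * w * h = h * (j * w)" by (simp add: j_left_commute w mult.assoc)
  ultimately have "(h - j * w) * (h + j * w) = 1"
    by (simp add: algebra_simps w(2))
  moreover have "h + j * w + (h - j * w) = 2 *\<^sub>R h" by (simp add: scaleR_2)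
  then have "h = (1/2) *\<^sub>R (h + j * w + (h - j * w))" by simp
  ultimately show ?thesis using that[of "h + j * w"] s by simp
qed

lemma norm_unitary: "star z * z = 1 \<Longrightarrow> norm z = 1"
  using norm_star_mult_self[of z] norm_ge_zero[of z] by (auto simp: power2_eq_1_iff)

text \<open>Boundedness is forced by the algebra: \<open>T\<close> preserves the relation star z * z
  = 1, hence norm 1, so it is bounded on small self-adjoint elements and then everywhere by the
  C*-identity. The argument yields 4/3 for the squares, rounded up to 4.\<close>

lemma star_automorphism_norm_le:
  assumes T: "star_automorphism j star T"
  shows "norm (T a) \<le> 2 * norm a"
proof -
  have add: "T (a + b) = T a + T b" and mult: "T (a * b) = T a * T b"
    and st: "T (star a) = star (T a)" and cs: "T (cscale j c a) = cscale j c (T a)" for a b c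
    using T by (auto simp: star_automorphism_def)
  have sc: "T (r *\<^sub>R a) = r *\<^sub>R T a" for r a using cs[of "of_real r" a] by (simp add: cscale_of_real)
  \<comment> \<open>Surjectivity makes \<open>T\<close> unital: T 1 = T 1 * T u = T u = 1.\<close>
  obtain u where u: "T u = 1" using T unfolding star_automorphism_def by (metis bij_pointE)
  then have one: "T 1 = 1" using mult[of 1 u] by simp
  have T0: "T 0 = 0" using sc[of 0 0] by simp
  have unit: "norm (T h) \<le> 1" if h: "star h = h" "norm h \<le> 3/4" for h
  proof -
    obtain z where z: "star z * z = 1" "h = (1/2) *\<^sub>R (z + star z)"
      using selfadjoint_average_of_unitary[OF h] by blast
    have "norm (T z) = 1" using norm_unitary[of "T z"] z(1) one by (metis mult st)
    then have "norm (T (star z)) = 1" by (simp add: st norm_star)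
    with \<open>norm (T z) = 1\<close> show ?thesis
      using norm_triangle_ineq[of "T z" "T (star z)"] by (simp add: z(2) sc add)
  qed
  show ?thesis
  proof (cases "a = 0")
    case False
    \<comment> \<open>By the C*-identity this scaling gives \<open>h\<close> norm exactly
      3/4.\<close>
    define h where "h = (3/4 / (norm a)\<^sup>2) *\<^sub>R (star a * a)"
    have "star h = h" by (simp add: h_def star_scaleR star_mult star_star)
    moreover have "norm h \<le> 3/4" using False by (simp add: h_def norm_star_mult_self)
    ultimately have "norm (T h) \<le> 1" using unit by blast
    moreover have "norm (T h) = (3/4 / (norm a)\<^sup>2) * (norm (T a))\<^sup>2"
      by (simp add: h_def sc mult st norm_star_mult_self)
    ultimately have "3 * (norm (T a))\<^sup>2 \<le> 4 * (norm a)\<^sup>2"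
      using False by (simp add: field_simps)
    then have "(norm (T a))\<^sup>2 \<le> (2 * norm a)\<^sup>2"
      using zero_le_power2[of "norm (T a)"] unfolding power_mult_distrib power2_eq_square[of "2::real"] by linarith
    then show ?thesis by (rule power2_le_imp_le) simp
  qed (simp add: T0)
qed

end

section \<open>Positivity, Cauchy-Schwarz and boundedness of states\<close>

locale cstar_state = cstar_algebra j star
  for j :: "'a::{real_normed_algebra_1, banach}" and star :: "'a \<Rightarrow> 'a" +
  fixes \<omega> :: "'a \<Rightarrow> complex"
  assumes state: "is_state j star \<omega>"
begin

lemma state_add: "\<omega> (a + b) = \<omega> a + \<omega> b"
  using state by (simp add: is_state_def)

lemma state_cscale: "\<omega> (cscale j c a) = c * \<omega> a"
  using state by (simp add: is_state_def)

lemma state_one: "\<omega> 1 = 1"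
  using state by (simp add: is_state_def)

lemma state_positive: "Im (\<omega> (star a * a)) = 0" "0 \<le> Re (\<omega> (star a * a))"
  using state by (auto simp: is_state_def)

lemma state_scaleR: "\<omega> (r *\<^sub>R a) = of_real r * \<omega> a"
  using state_cscale[of "of_real r" a] by (simp add: cscale_of_real)

lemma state_j_mult: "\<omega> (j * a) = \<i> * \<omega> a"
  using state_cscale[of \<i> a] by (simp add: cscale_ii)

lemma state_minus: "\<omega> (- a) = - \<omega> a"
  using state_scaleR[of "-1" a] by simp

lemma state_diff: "\<omega> (a - b) = \<omega> a - \<omega> b"
  using state_add[of a "- b"] by (simp add: state_minus)

text \<open>Polarisation: positivity makes the values at the squares of 1 + a and 1 + i a real,
  which yields the imaginary and the real part of the identity respectively.\<close>

lemma state_star: "\<omega> (star a) = cnj (\<omega> a)"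
proof -
  have "star (1 + a) * (1 + a) = 1 + a + star a + star a * a"
    by (simp add: star_add star_one algebra_simps)
  then have "Im (\<omega> (1 + a + star a + star a * a)) = 0"
    using state_positive(1)[of "1 + a"] by simp
  then have 1: "Im (\<omega> a) + Im (\<omega> (star a)) = 0"
    by (simp add: state_add state_one state_positive)
  have "j * (star a * (j * a)) = - (star a * a)"
    by (metis j_left_commute j_square_mult)
  then have "star (1 + j * a) * (1 + j * a) = 1 + j * a - j * star a + star a * a"
    by (simp add: star_add star_one star_j_mult algebra_simps)
  then have "Im (\<omega> (1 + j * a - j * star a + star a * a)) = 0"
    using state_positive(1)[of "1 + j * a"] by simp
  then have 2: "Re (\<omega> a) - Re (\<omega> (star a)) = 0"
    by (simp add: state_add state_diff state_one state_positive state_j_mult)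
  show ?thesis using 1 2 by (simp add: complex_eq_iff)
qed

lemma state_star_mult_swap: "\<omega> (star x * y) = cnj (\<omega> (star y * x))"
  using state_star[of "star y * x"] by (simp add: star_mult star_star)

lemma mult_cscale: "x * cscale j c y = cscale j c (x * y)" "cscale j c x * y = cscale j c (x * y)"
  by (simp_all add: cscale_def distrib_left distrib_right j_left_commute mult.assoc)

lemma state_square_add_cscale:
  "Re (\<omega> (star (x + cscale j c y) * (x + cscale j c y))) =
   Re (\<omega> (star x * x)) + 2 * Re (c * \<omega> (star x * y)) + (cmod c)\<^sup>2 * Re (\<omega> (star y * y))"
proof -
  have "\<omega> (star (x + cscale j c y) * (x + cscale j c y)) =
    \<omega> (star x * x) + c * \<omega> (star x * y) + cnj c * \<omega> (star y * x) + cnj c * (c * \<omega> (star y * y))"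
    by (simp add: star_add star_cscale distrib_left distrib_right mult_cscale state_add state_cscale)
  moreover have "cnj c * \<omega> (star y * x) = cnj (c * \<omega> (star x * y))"
    by (simp add: state_star_mult_swap[of y x])
  moreover have "Re (cnj c * (c * \<omega> (star y * y))) = (cmod c)\<^sup>2 * Re (\<omega> (star y * y))"
    by (simp add: cmod_power2 state_positive) (simp add: algebra_simps power2_eq_square)
  ultimately show ?thesis by simp
qed

text \<open>The square of x - t * cnj p * y is nonnegative for every real t. The form may be
  degenerate, so r = 0 is treated separately; otherwise t = 1/r is optimal.\<close>

lemma state_Cauchy_Schwarz:
  "(cmod (\<omega> (star x * y)))\<^sup>2 \<le> Re (\<omega> (star x * x)) * Re (\<omega> (star y * y))"
proof -
  define p q r where "p = \<omega> (star x * y)" and "q = Re (\<omega> (star x * x))" and "r = Re (\<omega> (star y * y))"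
  have *: "0 \<le> q - 2 * t * (cmod p)\<^sup>2 + t\<^sup>2 * (cmod p)\<^sup>2 * r" for t
  proof -
    have "Re (- (of_real t * cnj p) * p) = - t * (cmod p)\<^sup>2"
      unfolding cmod_power2 by (simp add: algebra_simps power2_eq_square)
    then show ?thesis
      using state_square_add_cscale[of x "- (of_real t * cnj p)" y]
        state_positive(2)[of "x + cscale j (- (of_real t * cnj p)) y"]
      unfolding p_def[symmetric] q_def[symmetric] r_def[symmetric]
      by (simp add: norm_mult power_mult_distrib)
  qed
  have q: "q \<ge> 0" and r: "r \<ge> 0" using state_positive by (auto simp: q_def r_def)
  show ?thesis
  proof (cases "r = 0")
    case True
    have "p = 0"
    proof (rule ccontr)
      assume "p \<noteq> 0"
      \<comment> \<open>With r = 0 this value of t turns the right-hand side into q - (q + 1) =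
        -1.\<close>
      then show False using *[of "(q + 1) / (2 * (cmod p)\<^sup>2)"] True by simp
    qed
    then show ?thesis using True by (simp add: p_def q_def r_def)
  next
    case False
    then have "(1 / r)\<^sup>2 * (cmod p)\<^sup>2 * r = (cmod p)\<^sup>2 / r"
      by (simp add: power2_eq_square)
    then have "(cmod p)\<^sup>2 / r \<le> q" using *[of "1 / r"] by simp
    then show ?thesis using False r
      unfolding p_def[symmetric] q_def[symmetric] r_def[symmetric]
      by (simp add: pos_divide_le_eq)
  qed
qed

text \<open>Cauchy-Schwarz against 1 bounds the state on elements with star z * z = 1, hence on
  small self-adjoint ones. A second use of it passes from \<open>a\<close> to star a * a.\<close>

lemma state_norm_le: "cmod (\<omega> a) \<le> 2 * norm a"
proof -
  have CS: "(cmod (\<omega> b))\<^sup>2 \<le> Re (\<omega> (star b * b))" for b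
    using state_Cauchy_Schwarz[of 1 b] by (simp add: star_one state_one)
  have unit: "cmod (\<omega> h) \<le> 1" if h: "star h = h" "norm h \<le> 3/4" for h
  proof -
    obtain z where z: "star z * z = 1" "h = (1/2) *\<^sub>R (z + star z)"
      using selfadjoint_average_of_unitary[OF h] by blast
    have "(cmod (\<omega> z))\<^sup>2 \<le> 1" using CS[of z] by (simp add: z state_one)
    then have "cmod (\<omega> z) \<le> 1" by (simp add: power2_le_imp_le[of _ 1])
    then show ?thesis
      using norm_triangle_ineq[of "\<omega> z" "cnj (\<omega> z)"]
      by (simp add: z(2) state_scaleR state_add state_star norm_mult)
  qed
  show ?thesis
  proof (cases "a = 0")
    case False
    define h where "h = (3/4 / (norm a)\<^sup>2) *\<^sub>R (star a * a)"
    have "star h = h" by (simp add: h_def star_scaleR star_mult star_star)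
    moreover have "norm h \<le> 3/4" using False by (simp add: h_def norm_star_mult_self)
    ultimately have "cmod (\<omega> h) \<le> 1" using unit by blast
    then have "Re (\<omega> h) \<le> 1" using complex_Re_le_cmod order_trans by blast
    moreover have "Re (\<omega> h) = (3/4 / (norm a)\<^sup>2) * Re (\<omega> (star a * a))"
      by (simp add: h_def state_scaleR)
    ultimately have "3 * Re (\<omega> (star a * a)) \<le> 4 * (norm a)\<^sup>2"
      using False by (simp add: field_simps)
    then have "(cmod (\<omega> a))\<^sup>2 \<le> (2 * norm a)\<^sup>2"
      using CS[of a] state_positive(2)[of a] unfolding power_mult_distrib by simp
    then show ?thesis by (rule power2_le_imp_le) simp
  next
    case True
    then show ?thesis using state_scaleR[of 0 0] by simp
  qed
qed

lemma bounded_linear_state: "bounded_linear \<omega>"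
proof (rule bounded_linear_intro[of _ 2])
  show "\<omega> (r *\<^sub>R a) = r *\<^sub>R \<omega> a" for r a
    by (simp add: state_scaleR flip: scaleR_conv_of_real)
  show "norm (\<omega> a) \<le> norm a * 2" for a
    using state_norm_le[of a] by simp
qed (rule state_add)

text \<open>Each mixed term occurs twice, with weight at most S because 2 |c_i| |c_k| is at most
  |c_i|^2 + |c_k|^2. \<open>S\<close> bounds single coefficients and is not tied to the sum, so it
  stays fixed while the induction lengthens the sum.\<close>

lemma state_square_sum_cscale_le:
  fixes x :: "nat \<Rightarrow> 'a" and c :: "nat \<Rightarrow> complex"
  assumes B: "\<And>i. i < N \<Longrightarrow> Re (\<omega> (star (x i) * x i)) \<le> B"
    and c: "\<And>i. i < N \<Longrightarrow> (cmod (c i))\<^sup>2 \<le> S"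
  shows "Re (\<omega> (star (\<Sum>i<N. cscale j (c i) (x i)) * (\<Sum>i<N. cscale j (c i) (x i))))
    \<le> (\<Sum>i<N. (cmod (c i))\<^sup>2) * B + 2 * S * (\<Sum>k<N. \<Sum>i<k. cmod (\<omega> (star (x i) * x k)))"
  using assms
proof (induction N)
  case 0
  then show ?case using state_scaleR[of 0 0] by simp
next
  case (Suc N)
  define y where "y = (\<Sum>i<N. cscale j (c i) (x i))"
  define K where "K = (\<Sum>i<N. cmod (\<omega> (star (x i) * x N)))"
  have S: "S \<ge> 0" using Suc.prems(2)[of N] zero_le_power2[of "cmod (c N)"] by linarith
  have cc: "cmod (c i) * cmod (c N) \<le> S" if "i < N" for i
  proof -
    have "2 * (cmod (c i) * cmod (c N)) \<le> (cmod (c i))\<^sup>2 + (cmod (c N))\<^sup>2"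
      using sum_squares_bound[of "cmod (c i)" "cmod (c N)"] by simp
    then show ?thesis using Suc.prems(2)[of i] Suc.prems(2)[of N] that by simp
  qed
  have lin: "\<omega> (star (\<Sum>i<m. cscale j (c i) (x i)) * z) = (\<Sum>i<m. cnj (c i) * \<omega> (star (x i) * z))"
    for m z
  proof (induction m)
    case 0
    then show ?case using state_scaleR[of 0 0] star_scaleR[of 0 0] by simp
  qed (simp add: star_add star_cscale distrib_right mult_cscale state_add state_cscale)
  have "Re (c N * \<omega> (star y * x N)) \<le> cmod (c N * \<omega> (star y * x N))"
    by (rule complex_Re_le_cmod)
  also have "\<dots> = cmod (\<Sum>i<N. c N * (cnj (c i) * \<omega> (star (x i) * x N)))"
    by (simp add: y_def lin sum_distrib_left)
  also have "\<dots> \<le> (\<Sum>i<N. (cmod (c i) * cmod (c N)) * cmod (\<omega> (star (x i) * x N)))"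
    by (rule sum_norm_le) (simp add: norm_mult)
  also have "\<dots> \<le> (\<Sum>i<N. S * cmod (\<omega> (star (x i) * x N)))"
    by (intro sum_mono mult_right_mono cc) auto
  finally have cross: "Re (c N * \<omega> (star y * x N)) \<le> S * K" by (simp add: K_def sum_distrib_left)
  have "(cmod (c N))\<^sup>2 * Re (\<omega> (star (x N) * x N)) \<le> (cmod (c N))\<^sup>2 * B"
    by (intro mult_left_mono Suc.prems) auto
  moreover have "Re (\<omega> (star y * y)) \<le> (\<Sum>i<N. (cmod (c i))\<^sup>2) * B
      + 2 * S * (\<Sum>k<N. \<Sum>i<k. cmod (\<omega> (star (x i) * x k)))"
    unfolding y_def using Suc by auto
  ultimately show ?case
    using cross state_square_add_cscale[of y "c N" "x N"]
    by (simp add: y_def[symmetric] K_def[symmetric] algebra_simps)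
qed

text \<open>A Boas--Bellman type inequality; it replaces the passage to the product system
  \<open>A \<otimes> A\<close> in the van der Corput argument.\<close>

lemma state_Boas_Bellman:
  fixes x :: "nat \<Rightarrow> 'a"
  assumes B0: "0 \<le> B" and B: "\<And>i. i < N \<Longrightarrow> Re (\<omega> (star (x i) * x i)) \<le> B"
  shows "(\<Sum>i<N. (cmod (\<omega> (a * x i)))\<^sup>2)
    \<le> Re (\<omega> (a * star a)) * (B + 2 * (\<Sum>k<N. \<Sum>i<k. cmod (\<omega> (star (x i) * x k))))"
proof -
  \<comment> \<open>Conjugate coefficients make \<omega> (a * y) equal to S, the sum to be
    estimated. Cauchy-Schwarz then gives S^2 \<le> Q * S * R, and one factor S cancels.\<close>
  define c where "c = (\<lambda>i. cnj (\<omega> (a * x i)))"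
  define S where "S = (\<Sum>i<N. (cmod (c i))\<^sup>2)"
  define y where "y = (\<Sum>i<N. cscale j (c i) (x i))"
  define Q where "Q = Re (\<omega> (a * star a))"
  define R where "R = B + 2 * (\<Sum>k<N. \<Sum>i<k. cmod (\<omega> (star (x i) * x k)))"
  have Q: "Q \<ge> 0" using state_positive(2)[of "star a"] by (simp add: Q_def star_star)
  have S: "S \<ge> 0" by (simp add: S_def sum_nonneg)
  have yy: "Re (\<omega> (star y * y)) \<le> S * R"
    using state_square_sum_cscale_le[OF B, where c=c and S=S] member_le_sum[of _ "{..<N}" "\<lambda>i. (cmod (c i))\<^sup>2"]
    unfolding y_def R_def S_def[symmetric] by (auto simp: S_def algebra_simps)
  have "\<omega> (a * (\<Sum>i<m. cscale j (c i) (x i))) = (\<Sum>i<m. of_real ((cmod (c i))\<^sup>2))" for m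
  proof (induction m)
    case 0
    then show ?case using state_scaleR[of 0 0] by simp
  next
    case (Suc m)
    have "c m * \<omega> (a * x m) = of_real ((cmod (c m))\<^sup>2)"
      by (metis c_def complex_cnj_cnj complex_norm_square)
    with Suc show ?case by (simp add: distrib_left mult_cscale state_add state_cscale)
  qed
  then have "\<omega> (a * y) = of_real S" by (simp add: y_def S_def)
  then have "S\<^sup>2 \<le> Q * Re (\<omega> (star y * y))"
    using state_Cauchy_Schwarz[of "star a" y] S by (simp add: star_star Q_def)
  also have "\<dots> \<le> Q * (S * R)" by (intro mult_left_mono yy Q)
  finally have SS: "S * S \<le> S * (Q * R)" by (simp add: power2_eq_square ac_simps)
  have "0 \<le> R" unfolding R_def
    by (intro add_nonneg_nonneg mult_nonneg_nonneg sum_nonneg B0) auto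
  then have "S \<le> Q * R" using SS S Q by (cases "S = 0") auto
  then show ?thesis by (simp add: S_def Q_def R_def c_def)
qed

end

section \<open>Averages along a Folner sequence\<close>

locale folner_averages =
  fixes \<mu> :: "'g::{topological_ab_group_add, t2_space, second_countable_topology} measure"
    and \<Lambda> :: "nat \<Rightarrow> 'g set"
  assumes haar: "haar_measure \<mu>" and folner: "folner_seq \<mu> \<Lambda>"
begin

lemma sets_haar [measurable_cong]: "sets \<mu> = sets borel"
  using haar by (simp add: haar_measure_def)

lemma compact_\<Lambda>: "compact (\<Lambda> n)"
  using folner by (simp add: folner_seq_def)

lemma compact_measurable: "compact K \<Longrightarrow> K \<in> sets \<mu>"
  by (simp add: sets_haar borel_closed compact_imp_closed)

lemma compact_finite: "compact K \<Longrightarrow> emeasure \<mu> K < \<infinity>"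
  using haar by (simp add: haar_measure_def)

lemma measure_\<Lambda>_pos: "0 < measure \<mu> (\<Lambda> n)"
  using folner compact_finite[OF compact_\<Lambda>, of n]
  by (auto simp: folner_seq_def measure_def enn2real_positive_iff)

text \<open>Invariance is given for images of Borel sets. In this form it serves as a change of
  variables in integrals; the preimage under translation by \<open>h\<close> is the image under
  translation by - h.\<close>

lemma distr_translate: "distr \<mu> borel (\<lambda>x. x + h) = \<mu>"
proof (rule measure_eqI)
  show "sets (distr \<mu> borel (\<lambda>x. x + h)) = sets \<mu>" by (simp add: sets_haar)
  fix A assume "A \<in> sets (distr \<mu> borel (\<lambda>x. x + h))"
  then have A: "A \<in> sets borel" by simp
  have m: "(\<lambda>x. x + h) \<in> \<mu> \<rightarrow>\<^sub>M borel"
    unfolding measurable_cong_sets[OF sets_haar refl]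
    by (intro borel_measurable_continuous_onI continuous_intros)
  have "(\<lambda>x. x + h) -` A = (\<lambda>x. - h + x) ` A"
    by (auto simp: image_iff intro!: bexI[of _ "_ + h"])
  then have "emeasure \<mu> ((\<lambda>x. x + h) -` A) = emeasure \<mu> A"
    using haar A unfolding haar_measure_def by metis
  then show "emeasure (distr \<mu> borel (\<lambda>x. x + h)) A = emeasure \<mu> A"
    using emeasure_distr[OF m A] sets_eq_imp_space_eq[OF sets_haar] by simp
qed

text \<open>Such functions are integrable over every compact set, which makes the averages additive
  and monotone.\<close>

definition bdd_cont :: "('g \<Rightarrow> real) \<Rightarrow> bool" where
  "bdd_cont f \<longleftrightarrow> continuous_on UNIV f \<and> (\<exists>B. \<forall>g. \<bar>f g\<bar> \<le> B)"

lemma bdd_contI: "continuous_on UNIV f \<Longrightarrow> (\<And>g. \<bar>f g\<bar> \<le> B) \<Longrightarrow> bdd_cont f"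
  unfolding bdd_cont_def by blast

lemma bdd_contD: "bdd_cont f \<Longrightarrow> \<exists>B. \<forall>g. \<bar>f g\<bar> \<le> B" "bdd_cont f \<Longrightarrow> continuous_on UNIV f"
  by (auto simp: bdd_cont_def)

lemma borel_measurable_cont:
  "continuous_on UNIV (f :: 'g \<Rightarrow> real) \<Longrightarrow> f \<in> borel_measurable \<mu>"
  using borel_measurable_continuous_onI measurable_cong_sets[OF sets_haar refl] by blast

lemma set_integrable_bdd_cont:
  assumes "bdd_cont f" "compact K"
  shows "set_integrable \<mu> K f"
proof -
  obtain B where "\<And>g. \<bar>f g\<bar> \<le> B" "continuous_on UNIV f"
    using bdd_contD[OF assms(1)] by blast
  then show ?thesis unfolding set_integrable_def
    using assms(2) by (intro integrableI_bounded_set_indicator[where B=B])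
      (auto intro: compact_measurable compact_finite borel_measurable_cont simp del: infinity_ennreal_def)
qed

lemma bdd_cont_add: "bdd_cont f \<Longrightarrow> bdd_cont g \<Longrightarrow> bdd_cont (\<lambda>x. f x + g x)"
  unfolding bdd_cont_def
  by (auto intro!: continuous_intros) (meson abs_triangle_ineq add_mono order_trans)

lemma bdd_cont_cmult:
  assumes "bdd_cont f"
  shows "bdd_cont (\<lambda>x. c * f x)"
proof -
  obtain B where "\<And>g. \<bar>f g\<bar> \<le> B" "continuous_on UNIV f"
    using bdd_contD[OF assms] by blast
  then show ?thesis
    by (intro bdd_contI[of _ "\<bar>c\<bar> * B"] continuous_intros) (auto simp: abs_mult mult_left_mono)
qed

lemma bdd_cont_const: "bdd_cont (\<lambda>x. c)"
  by (rule bdd_contI[of _ "\<bar>c\<bar>"]) auto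

lemma bdd_cont_translate: "bdd_cont f \<Longrightarrow> bdd_cont (\<lambda>x. f (x + h))"
  unfolding bdd_cont_def
  by (auto intro!: continuous_intros continuous_on_compose2[of UNIV f])

lemma bdd_cont_sum: "(\<And>i. i \<in> I \<Longrightarrow> bdd_cont (f i)) \<Longrightarrow> bdd_cont (\<lambda>x. \<Sum>i\<in>I. f i x)"
proof (induction I rule: infinite_finite_induct)
  case (insert i I)
  then show ?case using bdd_cont_add[of "f i" "\<lambda>x. \<Sum>i\<in>I. f i x"] by simp
qed (use bdd_cont_const in auto)

section \<open>Linearity, monotonicity and asymptotic translation invariance of averages\<close>

abbreviation avg :: "nat \<Rightarrow> ('g \<Rightarrow> real) \<Rightarrow> real" where
  "avg n f \<equiv> favg \<mu> (\<Lambda> n) f"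

lemma avg_add: "bdd_cont f \<Longrightarrow> bdd_cont g \<Longrightarrow> avg n (\<lambda>x. f x + g x) = avg n f + avg n g"
  unfolding favg_def
  by (subst set_integral_add) (auto simp: set_integrable_bdd_cont compact_\<Lambda> distrib_left)

lemma avg_cmult: "avg n (\<lambda>x. c * f x) = c * avg n f"
  by (simp add: favg_def)

lemma avg_const: "avg n (\<lambda>x. c) = c"
  using measure_\<Lambda>_pos[of n] compact_finite[OF compact_\<Lambda>, of n]
  by (simp add: favg_def set_lebesgue_integral_def compact_measurable compact_\<Lambda>)

lemma avg_mono: "bdd_cont f \<Longrightarrow> bdd_cont g \<Longrightarrow> (\<And>x. f x \<le> g x) \<Longrightarrow> avg n f \<le> avg n g"
  unfolding favg_def using measure_\<Lambda>_pos[of n]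
  by (intro mult_left_mono set_integral_mono) (auto simp: set_integrable_bdd_cont compact_\<Lambda>)

lemma avg_sum:
  "(\<And>i. i \<in> I \<Longrightarrow> bdd_cont (f i)) \<Longrightarrow> avg n (\<lambda>x. \<Sum>i\<in>I. f i x) = (\<Sum>i\<in>I. avg n (f i))"
proof (induction I rule: infinite_finite_induct)
  case (insert i I)
  then show ?case
    using avg_add[of "f i" "\<lambda>x. \<Sum>i\<in>I. f i x"] bdd_cont_sum[of I f] by simp
qed (simp_all add: avg_const)

text \<open>Translating the function amounts to translating the domain. The two integrals then
  differ only on the symmetric difference of the domains, whose relative measure tends to 0 by the
  Folner property.\<close>

lemma avg_translate_diff:
  assumes f: "bdd_cont f"
  shows "(\<lambda>n. avg n (\<lambda>x. f (x + h)) - avg n f) \<longlonglongrightarrow> 0"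
proof -
  obtain B where B: "\<And>g. \<bar>f g\<bar> \<le> B" and cf: "continuous_on UNIV f"
    using bdd_contD[OF f] by blast
  define \<Lambda>' where "\<Lambda>' = (\<lambda>n. rtrans (\<Lambda> n) h)"
  define D where "D = (\<lambda>n. (\<Lambda> n - \<Lambda>' n) \<union> (\<Lambda>' n - \<Lambda> n))"
  have c': "compact (\<Lambda>' n)" for n
    unfolding \<Lambda>'_def rtrans_def by (intro compact_continuous_image compact_\<Lambda> continuous_intros)
  have "\<bar>avg n (\<lambda>x. f (x + h)) - avg n f\<bar> \<le> B * (measure \<mu> (D n) / measure \<mu> (\<Lambda> n))" for n
  proof -
    have mD: "D n \<in> sets \<mu>" using compact_measurable c' compact_\<Lambda> by (auto simp: D_def)
    have "emeasure \<mu> (D n) \<le> emeasure \<mu> (\<Lambda> n \<union> \<Lambda>' n)"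
      using compact_measurable c' compact_\<Lambda> by (intro emeasure_mono) (auto simp: D_def)
    also have "\<dots> < \<infinity>" by (intro compact_finite compact_Un c' compact_\<Lambda>)
    finally have fD: "emeasure \<mu> (D n) < \<infinity>" .
    have m: "(\<lambda>x. x + h) \<in> \<mu> \<rightarrow>\<^sub>M borel"
      unfolding measurable_cong_sets[OF sets_haar refl]
      by (intro borel_measurable_continuous_onI continuous_intros)
    have mf: "(\<lambda>x. indicator (\<Lambda>' n) x * f x) \<in> borel_measurable borel"
      using compact_measurable[OF c', of n] borel_measurable_continuous_onI[OF cf]
      by (intro borel_measurable_times borel_measurable_indicator) (auto simp: sets_haar)
    have ind: "indicator (\<Lambda>' n) (x + h) = (indicator (\<Lambda> n) x :: real)" for x
      by (auto simp: \<Lambda>'_def rtrans_def indicator_def)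
    have "(LINT x:\<Lambda>' n|\<mu>. f x) = integral\<^sup>L (distr \<mu> borel (\<lambda>x. x + h)) (\<lambda>x. indicator (\<Lambda>' n) x * f x)"
      by (simp add: distr_translate set_lebesgue_integral_def)
    also have "\<dots> = (LINT x:\<Lambda> n|\<mu>. f (x + h))"
      by (subst integral_distr[OF m mf]) (simp add: ind set_lebesgue_integral_def)
    finally have eq: "(LINT x:\<Lambda> n|\<mu>. f (x + h)) = (LINT x:\<Lambda>' n|\<mu>. f x)" by simp
    have i1: "integrable \<mu> (\<lambda>x. indicator (\<Lambda>' n) x *\<^sub>R f x)" and i2: "integrable \<mu> (\<lambda>x. indicator (\<Lambda> n) x *\<^sub>R f x)"
      using set_integrable_bdd_cont[OF f c'] set_integrable_bdd_cont[OF f compact_\<Lambda>]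
      by (auto simp: set_integrable_def)
    have "\<bar>(LINT x:\<Lambda>' n|\<mu>. f x) - (LINT x:\<Lambda> n|\<mu>. f x)\<bar>
        = \<bar>LINT x|\<mu>. (indicator (\<Lambda>' n) x *\<^sub>R f x - indicator (\<Lambda> n) x *\<^sub>R f x)\<bar>"
      unfolding set_lebesgue_integral_def by (subst Bochner_Integration.integral_diff[OF i1 i2]) simp
    also have "\<dots> \<le> (LINT x|\<mu>. indicator (D n) x * B)"
    proof (rule order_trans[OF integral_abs_bound integral_mono])
      show "integrable \<mu> (\<lambda>x. indicator (D n) x * B)"
        using mD fD by simp
      show "\<bar>indicator (\<Lambda>' n) x *\<^sub>R f x - indicator (\<Lambda> n) x *\<^sub>R f x\<bar> \<le> indicator (D n) x * B" for x
        using B[of x] by (auto simp: D_def indicator_def)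
    qed (use i1 i2 in auto)
    also have "\<dots> = B * measure \<mu> (D n)" using mD fD by simp
    finally have le: "\<bar>(LINT x:\<Lambda>' n|\<mu>. f x) - (LINT x:\<Lambda> n|\<mu>. f x)\<bar> \<le> B * measure \<mu> (D n)" .
    have "\<bar>avg n (\<lambda>x. f (x + h)) - avg n f\<bar>
      = \<bar>(LINT x:\<Lambda>' n|\<mu>. f x) - (LINT x:\<Lambda> n|\<mu>. f x)\<bar> / measure \<mu> (\<Lambda> n)"
      using measure_\<Lambda>_pos[of n] by (simp add: favg_def eq flip: diff_divide_distrib)
    also have "\<dots> \<le> B * measure \<mu> (D n) / measure \<mu> (\<Lambda> n)"
      using le by (simp add: divide_right_mono)
    finally show ?thesis by simp
  qed
  moreover have "(\<lambda>n. B * (measure \<mu> (D n) / measure \<mu> (\<Lambda> n))) \<longlonglongrightarrow> B * 0"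
    using folner unfolding folner_seq_def D_def \<Lambda>'_def by (intro tendsto_mult_left) blast
  then have "(\<lambda>n. B * (measure \<mu> (D n) / measure \<mu> (\<Lambda> n))) \<longlonglongrightarrow> 0" by simp
  ultimately show ?thesis
    using Lim_null_comparison[of "\<lambda>n. avg n (\<lambda>x. f (x + h)) - avg n f"
        "\<lambda>n. B * (measure \<mu> (D n) / measure \<mu> (\<Lambda> n))" sequentially]
    unfolding real_norm_def by (blast intro: always_eventually)
qed

section \<open>Nonnegative functions with vanishing averages\<close>

definition null_avg :: "('g \<Rightarrow> real) \<Rightarrow> bool" where
  "null_avg f \<longleftrightarrow> bdd_cont f \<and> (\<forall>g. 0 \<le> f g) \<and> (\<lambda>n. avg n f) \<longlonglongrightarrow> 0"

lemma null_avgD: "null_avg f \<Longrightarrow> bdd_cont f" "null_avg f \<Longrightarrow> 0 \<le> f g"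
    "null_avg f \<Longrightarrow> (\<lambda>n. avg n f) \<longlonglongrightarrow> 0"
  by (auto simp: null_avg_def)

lemma null_avg_add:
  assumes "null_avg f" "null_avg g"
  shows "null_avg (\<lambda>x. f x + g x)"
  using assms bdd_cont_add[of f g] tendsto_add[OF null_avgD(3)[OF assms(1)] null_avgD(3)[OF assms(2)]]
  by (auto simp: null_avg_def avg_add)

lemma null_avg_cmult:
  assumes "null_avg f" "0 \<le> c"
  shows "null_avg (\<lambda>x. c * f x)"
  using assms bdd_cont_cmult[of f c] tendsto_mult_left[OF null_avgD(3)[OF assms(1)], of c]
  by (auto simp: null_avg_def avg_cmult)

lemma null_avg_zero: "null_avg (\<lambda>x. 0)"
  using bdd_cont_const[of 0] by (auto simp: null_avg_def avg_const)

lemma null_avg_sum: "(\<And>i. i \<in> I \<Longrightarrow> null_avg (f i)) \<Longrightarrow> null_avg (\<lambda>x. \<Sum>i\<in>I. f i x)"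
proof (induction I rule: infinite_finite_induct)
  case (insert i I)
  then show ?case using null_avg_add[of "f i" "\<lambda>x. \<Sum>i\<in>I. f i x"] by simp
qed (simp_all add: null_avg_zero)

lemma null_avg_translate:
  assumes "null_avg f"
  shows "null_avg (\<lambda>x. f (x + h))"
  using assms bdd_cont_translate[of f h]
    tendsto_add[OF avg_translate_diff[OF null_avgD(1)[OF assms], of h] null_avgD(3)[OF assms]]
  by (auto simp: null_avg_def)

text \<open>Domination principle behind the error estimates below: boundedness and vanishing
  averages pass from \<open>f\<close> to \<open>g\<close>, so only continuity of \<open>g\<close>
  has to be checked.\<close>

lemma null_avg_mono:
  assumes f: "null_avg f" and "continuous_on UNIV g" and "\<And>x. 0 \<le> g x" and le: "\<And>x. g x \<le> f x"
  shows "null_avg g"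
proof -
  obtain B where "\<And>x. \<bar>f x\<bar> \<le> B" using bdd_contD(1)[OF null_avgD(1)[OF f]] by blast
  then have g: "bdd_cont g"
    using assms by (intro bdd_contI[of _ B]) (auto simp: abs_le_iff intro: order_trans)
  have "0 \<le> avg n g" for n
    using avg_mono[OF bdd_cont_const[of 0] g] assms by (simp add: avg_const)
  moreover have "avg n g \<le> avg n f" for n by (intro avg_mono g null_avgD[OF f] le)
  ultimately have "(\<lambda>n. avg n g) \<longlonglongrightarrow> 0"
    by (intro tendsto_sandwich[OF _ _ tendsto_const null_avgD(3)[OF f]]) auto
  with g assms show ?thesis by (auto simp: null_avg_def)
qed

lemma null_avg_ex_less:
  assumes f: "null_avg f" and "0 < \<delta>"
  shows "\<exists>g. f g < \<delta>"
proof (rule ccontr)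
  assume "\<not> ?thesis"
  then have "\<delta> \<le> avg n f" for n
    using avg_mono[OF bdd_cont_const[of \<delta>] null_avgD(1)[OF f]] by (auto simp: avg_const not_less)
  then have "\<delta> \<le> 0" using LIMSEQ_le_const[OF null_avgD(3)[OF f]] by blast
  with assms show False by simp
qed

text \<open>The null sequence \<open>u\<close> may depend on \<epsilon>. This matters in the van der
  Corput argument, where the number of shifts depends on \<epsilon>.\<close>

lemma null_avgI:
  assumes f: "bdd_cont f" and pos: "\<And>x. 0 \<le> f x"
    and ev: "\<And>\<epsilon>. 0 < \<epsilon> \<Longrightarrow> \<exists>u. u \<longlonglongrightarrow> 0 \<and> (\<forall>n. avg n f \<le> \<epsilon> + u n)"
  shows "null_avg f"
proof -
  have ge: "0 \<le> avg n f" for n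
    using avg_mono[OF bdd_cont_const[of 0] f] pos by (simp add: avg_const)
  have "(\<lambda>n. avg n f) \<longlonglongrightarrow> 0"
  proof (rule LIMSEQ_I)
    fix r :: real assume r: "0 < r"
    then obtain u where u: "u \<longlonglongrightarrow> 0" "\<And>n. avg n f \<le> r / 2 + u n" using ev[of "r / 2"] by auto
    obtain N where "\<And>n. n \<ge> N \<Longrightarrow> norm (u n - 0) < r / 2" using LIMSEQ_D[OF u(1), of "r / 2"] r by auto
    then have "norm (avg n f - 0) < r" if "n \<ge> N" for n using u(2)[of n] ge[of n] that by force
    then show "\<exists>N. \<forall>n\<ge>N. norm (avg n f - 0) < r" by blast
  qed
  with f pos show ?thesis by (auto simp: null_avg_def)
qed

text \<open>Since f \<le> \<epsilon> + f^2 / \<epsilon> pointwise, the averages of \<open>f\<close>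
  are at most \<epsilon> plus a null sequence.\<close>

lemma null_avg_power2D:
  assumes sq: "null_avg (\<lambda>x. (f x)\<^sup>2)" and f: "bdd_cont f" and pos: "\<And>x. 0 \<le> f x"
  shows "null_avg f"
proof (rule null_avgI[OF f pos])
  fix \<epsilon> :: real assume e: "0 < \<epsilon>"
  have "f x \<le> \<epsilon> + (1 / \<epsilon>) * (f x)\<^sup>2" for x
  proof -
    have "2 * (\<epsilon> * f x) \<le> \<epsilon>\<^sup>2 + (f x)\<^sup>2" using sum_squares_bound[of \<epsilon> "f x"] by simp
    moreover have "0 \<le> \<epsilon> * f x" using e pos by simp
    ultimately have "\<epsilon> * f x \<le> \<epsilon>\<^sup>2 + (f x)\<^sup>2" by linarith
    then show ?thesis using e by (simp add: field_simps power2_eq_square)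
  qed
  then have "avg n f \<le> avg n (\<lambda>x. \<epsilon> + (1 / \<epsilon>) * (f x)\<^sup>2)" for n
    by (intro avg_mono f bdd_cont_add bdd_cont_const bdd_cont_cmult null_avgD[OF sq])
  then have "avg n f \<le> \<epsilon> + (1 / \<epsilon>) * avg n (\<lambda>x. (f x)\<^sup>2)" for n
    using avg_add[OF bdd_cont_const[of \<epsilon>] bdd_cont_cmult[OF null_avgD(1)[OF sq], of "1 / \<epsilon>"]] avg_const avg_cmult
    by metis
  moreover have "(\<lambda>n. (1 / \<epsilon>) * avg n (\<lambda>x. (f x)\<^sup>2)) \<longlonglongrightarrow> 0"
    using tendsto_mult_left[OF null_avgD(3)[OF sq], of "1 / \<epsilon>"] by simp
  ultimately show "\<exists>u. u \<longlonglongrightarrow> 0 \<and> (\<forall>n. avg n f \<le> \<epsilon> + u n)" by blast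
qed

text \<open>Greedy choice: given the earlier points, the sum of the translates of \<gamma> by them
  is again null, so it is below \<delta> at some point x. As \<gamma> is nonnegative, so is each
  summand below \<delta>.\<close>

lemma ex_separated_points:
  fixes N :: nat
  assumes \<gamma>: "null_avg \<gamma>" and "0 < \<delta>"
  shows "\<exists>h. \<forall>k<N. \<forall>i<k. \<gamma> (h k - h i) < \<delta>"
proof (induction N)
  case (Suc N)
  then obtain h where h: "\<forall>k<N. \<forall>i<k. \<gamma> (h k - h i) < \<delta>" by blast
  have "null_avg (\<lambda>x. \<Sum>i<N. \<gamma> (x + - h i))" by (intro null_avg_sum null_avg_translate \<gamma>)
  then obtain x where x: "(\<Sum>i<N. \<gamma> (x + - h i)) < \<delta>" using null_avg_ex_less assms(2) by blast
  have "\<gamma> (x - h i) < \<delta>" if "i < N" for i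
    using member_le_sum[of i "{..<N}" "\<lambda>i. \<gamma> (x + - h i)"] null_avgD(2)[OF \<gamma>] x that by auto
  with h have "\<forall>k<Suc N. \<forall>i<k. \<gamma> ((h(N := x)) k - (h(N := x)) i) < \<delta>"
    by (auto simp: less_Suc_eq)
  then show ?case by blast
qed auto

text \<open>Van der Corput's argument with finitely many shifts \<open>h\<^sub>i\<close>: these are chosen so that all
  correlations \<open>\<gamma> (h\<^sub>k - h\<^sub>i)\<close> are small, which only needs \<open>\<gamma>\<close> to be null along \<open>\<Lambda>\<close> itself.\<close>

lemma van_der_Corput:
  fixes F \<gamma> :: "'g \<Rightarrow> real" and E :: "'g \<Rightarrow> 'g \<Rightarrow> real"
  assumes F: "bdd_cont F" "\<And>x. 0 \<le> F x" and C: "0 \<le> C"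
    and \<gamma>: "null_avg \<gamma>" and E: "\<And>h. null_avg (E h)"
    and ineq: "\<And>(N::nat) h g. (\<Sum>i<N. F (g + h i))
      \<le> C + C * (\<Sum>k<N. \<Sum>i<k. \<gamma> (h k - h i) + E (h k - h i) (g + h i))"
  shows "null_avg F"
proof (rule null_avgI[OF F])
  fix \<epsilon> :: real assume e: "0 < \<epsilon>"
  \<comment> \<open>After division by N the constant 2 * C falls below \<epsilon>.\<close>
  obtain N where N: "2 * C / \<epsilon> < real N" using reals_Archimedean2 by blast
  moreover have "0 \<le> 2 * C / \<epsilon>" using C e by simp
  ultimately have N0: "0 < N" by (cases N) auto
  \<comment> \<open>Fewer than N^2 pairs occur, so the threshold 1 / N^2 keeps their total at most
    1.\<close>
  then obtain h where h: "\<And>k i. k < N \<Longrightarrow> i < k \<Longrightarrow> \<gamma> (h k - h i) < 1 / (real N)\<^sup>2"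
    using ex_separated_points[OF \<gamma>, of "1 / (real N)\<^sup>2" N] by auto
  have Gsum: "(\<Sum>k<N. \<Sum>i<k. \<gamma> (h k - h i)) \<le> 1"
  proof -
    have "(\<Sum>k<N. \<Sum>i<k. \<gamma> (h k - h i)) \<le> (\<Sum>k<N. \<Sum>i<k. 1 / (real N)\<^sup>2)"
      by (intro sum_mono less_imp_le h) auto
    also have "\<dots> \<le> (\<Sum>k<N. \<Sum>i<N. 1 / (real N)\<^sup>2)" by (intro sum_mono sum_mono2) auto
    also have "\<dots> = 1" using N0 by (simp add: power2_eq_square)
    finally show ?thesis .
  qed
  define R where "R = (\<lambda>g. \<Sum>k<N. \<Sum>i<k. E (h k - h i) (g + h i))"
  have R: "null_avg R" unfolding R_def by (intro null_avg_sum null_avg_translate E)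
  have pw: "(\<Sum>i<N. F (g + h i)) \<le> 2 * C + C * R g" for g
  proof -
    have "(\<Sum>i<N. F (g + h i)) \<le> C + C * ((\<Sum>k<N. \<Sum>i<k. \<gamma> (h k - h i)) + R g)"
      using ineq[where N=N and g=g and h=h] by (simp add: sum.distrib R_def)
    also have "\<dots> \<le> C + C * (1 + R g)" by (intro add_mono mult_left_mono Gsum C) auto
    finally show ?thesis by (simp add: algebra_simps)
  qed
  \<comment> \<open>The total error of replacing each shifted average by the unshifted one; it tends
    to 0 because N is fixed.\<close>
  define d where "d = (\<lambda>n. \<Sum>i<N. avg n (\<lambda>g. F (g + h i)) - avg n F)"
  have d: "d \<longlonglongrightarrow> 0" unfolding d_def
    by (rule tendsto_null_sum) (rule avg_translate_diff[OF F(1)])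
  have "avg n F \<le> \<epsilon> + (C * avg n R - d n) / real N" for n
  proof -
    have "real N * avg n F + d n = (\<Sum>i<N. avg n (\<lambda>g. F (g + h i)))"
      by (simp add: d_def sum_subtractf)
    also have "\<dots> = avg n (\<lambda>g. \<Sum>i<N. F (g + h i))"
      by (intro avg_sum[symmetric] bdd_cont_translate F)
    also have "\<dots> \<le> avg n (\<lambda>g. 2 * C + C * R g)"
    proof (rule avg_mono[OF _ _ pw])
      show "bdd_cont (\<lambda>g. \<Sum>i<N. F (g + h i))" by (rule bdd_cont_sum) (rule bdd_cont_translate[OF F(1)])
      show "bdd_cont (\<lambda>g. 2 * C + C * R g)"
        by (rule bdd_cont_add[OF bdd_cont_const bdd_cont_cmult[OF null_avgD(1)[OF R]]])
    qed
    also have "\<dots> = 2 * C + C * avg n R"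
      using avg_add[OF bdd_cont_const[of "2 * C"] bdd_cont_cmult[OF null_avgD(1)[OF R], of C], of n]
      by (simp add: avg_const avg_cmult)
    finally have "real N * avg n F \<le> 2 * C + (C * avg n R - d n)" by simp
    also have "2 * C \<le> \<epsilon> * real N" using N e by (simp add: field_simps)
    finally show ?thesis using N0 by (simp add: field_simps)
  qed
  moreover have "(\<lambda>n. (C * avg n R - d n) / real N) \<longlonglongrightarrow> (C * 0 - 0) / real N"
    by (intro tendsto_intros null_avgD[OF R] d) (use N0 in auto)
  ultimately show "\<exists>u. u \<longlonglongrightarrow> 0 \<and> (\<forall>n. avg n F \<le> \<epsilon> + u n)"
    by (intro exI[of _ "\<lambda>n. (C * avg n R - d n) / real N"]) auto
qed

end

section \<open>Mixing of all orders\<close>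

locale mixing_system = cstar_state j star \<omega> + folner_averages \<mu> \<Lambda>
  for j :: "'a::{real_normed_algebra_1, banach}" and star :: "'a \<Rightarrow> 'a" and \<omega> :: "'a \<Rightarrow> complex"
    and \<mu> :: "'g::{topological_ab_group_add, t2_space, second_countable_topology} measure"
    and \<Lambda> :: "nat \<Rightarrow> 'g set" +
  fixes M :: "('g \<Rightarrow> 'g) set" and \<tau> :: "'g \<Rightarrow> 'a \<Rightarrow> 'a"
  assumes hom: "\<forall>\<phi> \<in> M. group_hom \<phi>"
    and trans: "translational M"
    and sys: "cstar_dyn_system j star \<omega> \<tau>"
    and wm: "M_weakly_mixing \<mu> \<omega> \<tau> M \<Lambda>"
    and aa: "M_asymptotically_abelian \<mu> \<tau> M \<Lambda>"
begin

lemma automorphism: "star_automorphism j star (\<tau> g)"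
  using sys by (simp add: cstar_dyn_system_def)

lemma action_add: "\<tau> g (a + b) = \<tau> g a + \<tau> g b"
  and action_mult: "\<tau> g (a * b) = \<tau> g a * \<tau> g b"
  and action_star: "\<tau> g (star a) = star (\<tau> g a)"
  using automorphism[of g] by (auto simp: star_automorphism_def)

lemma action_diff: "\<tau> g (a - b) = \<tau> g a - \<tau> g b"
  by (metis action_add add_diff_cancel_right' diff_add_cancel)

lemma action_one: "\<tau> g 1 = 1"
proof -
  obtain u where "\<tau> g u = 1"
    using automorphism[of g] unfolding star_automorphism_def by (metis bij_pointE)
  then show ?thesis using action_mult[of g 1 u] by simp
qed

lemma action_action: "\<tau> g (\<tau> h a) = \<tau> (g + h) a"
  using sys unfolding cstar_dyn_system_def by (metis comp_apply)

lemma state_action: "\<omega> (\<tau> g a) = \<omega> a"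
  using sys by (simp add: cstar_dyn_system_def)

lemma norm_action_le: "norm (\<tau> g a) \<le> 2 * norm a"
  by (rule star_automorphism_norm_le[OF automorphism])

lemma hom_add: "\<phi> \<in> M \<Longrightarrow> \<phi> (g + h) = \<phi> g + \<phi> h"
  using hom by (auto simp: group_hom_def)

lemma diff_mem: "\<phi> \<in> M \<Longrightarrow> \<psi> \<in> M \<Longrightarrow> \<phi> \<noteq> \<psi> \<Longrightarrow> (\<lambda>g. - \<psi> g + \<phi> g) \<in> M"
  using trans by (auto simp: translational_def)

lemma continuous_orbit: "\<phi> \<in> M \<Longrightarrow> continuous_on UNIV (\<lambda>g. \<tau> (\<phi> g) a)"
  using aa by (auto simp: M_asymptotically_abelian_def)

lemma continuous_state: "continuous_on UNIV f \<Longrightarrow> continuous_on UNIV (\<lambda>x. \<omega> (f x))"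
  by (rule bounded_linear.continuous_on[OF bounded_linear_state])

lemma continuous_star: "continuous_on UNIV f \<Longrightarrow> continuous_on UNIV (\<lambda>x. star (f x))"
  by (rule bounded_linear.continuous_on[OF bounded_linear_star])

lemma weak_mixing_null:
  assumes "\<phi> \<in> M"
  shows "null_avg (\<lambda>g. cmod (\<omega> (a * \<tau> (\<phi> g) b) - \<omega> a * \<omega> b))"
  unfolding null_avg_def
proof (intro conjI)
  show "bdd_cont (\<lambda>g. cmod (\<omega> (a * \<tau> (\<phi> g) b) - \<omega> a * \<omega> b))"
  proof (rule bdd_contI)
    show "continuous_on UNIV (\<lambda>g. cmod (\<omega> (a * \<tau> (\<phi> g) b) - \<omega> a * \<omega> b))"
      by (intro continuous_intros continuous_state continuous_orbit assms)
    fix g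
    have "cmod (\<omega> (a * \<tau> (\<phi> g) b)) \<le> 2 * (norm a * (2 * norm b))"
      using state_norm_le[of "a * \<tau> (\<phi> g) b"] norm_mult_ineq[of a "\<tau> (\<phi> g) b"]
        mult_left_mono[OF norm_action_le[of "\<phi> g" b], of "norm a"] by simp
    then show "\<bar>cmod (\<omega> (a * \<tau> (\<phi> g) b) - \<omega> a * \<omega> b)\<bar> \<le> 2 * (norm a * (2 * norm b)) + cmod (\<omega> a * \<omega> b)"
      using norm_triangle_ineq4[of "\<omega> (a * \<tau> (\<phi> g) b)" "\<omega> a * \<omega> b"] by simp
  qed
qed (use wm assms in \<open>auto simp: M_weakly_mixing_def\<close>)

lemma asymptotic_abelian_null:
  assumes "\<phi> \<in> M"
  shows "null_avg (\<lambda>g. norm (a * \<tau> (\<phi> g) b - \<tau> (\<phi> g) b * a))"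
  unfolding null_avg_def
proof (intro conjI)
  show "bdd_cont (\<lambda>g. norm (a * \<tau> (\<phi> g) b - \<tau> (\<phi> g) b * a))"
  proof (rule bdd_contI)
    show "continuous_on UNIV (\<lambda>g. norm (a * \<tau> (\<phi> g) b - \<tau> (\<phi> g) b * a))"
      by (intro continuous_intros continuous_orbit assms)
    fix g
    have "norm (a * \<tau> (\<phi> g) b) \<le> norm a * (2 * norm b)" "norm (\<tau> (\<phi> g) b * a) \<le> norm a * (2 * norm b)"
      using norm_mult_ineq[of a "\<tau> (\<phi> g) b"] norm_mult_ineq[of "\<tau> (\<phi> g) b" a]
        mult_left_mono[OF norm_action_le[of "\<phi> g" b], of "norm a"] by (simp_all add: mult.commute)
    then show "\<bar>norm (a * \<tau> (\<phi> g) b - \<tau> (\<phi> g) b * a)\<bar> \<le> norm a * (2 * norm b) + norm a * (2 * norm b)"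
      using norm_triangle_ineq4[of "a * \<tau> (\<phi> g) b" "\<tau> (\<phi> g) b * a"] by simp
  qed
qed (use aa assms in \<open>auto simp: M_asymptotically_abelian_def\<close>)

section \<open>Ordered products along orbits and their correlations\<close>

definition orbit_prod :: "(('g \<Rightarrow> 'g) \<times> 'a) list \<Rightarrow> 'g \<Rightarrow> 'a" where
  "orbit_prod ps g = prod_list (map (\<lambda>(\<phi>, a). \<tau> (\<phi> g) a) ps)"

definition state_prod :: "(('g \<Rightarrow> 'g) \<times> 'a) list \<Rightarrow> complex" where
  "state_prod ps = prod_list (map (\<lambda>(\<phi>, a). \<omega> a) ps)"

text \<open>The list whose orbit product is the rearranged form of U_g^* U_{g+h}: the two factors
  belonging to the same homomorphism are merged.\<close>

definition correlate :: "'g \<Rightarrow> (('g \<Rightarrow> 'g) \<times> 'a) list \<Rightarrow> (('g \<Rightarrow> 'g) \<times> 'a) list" where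
  "correlate h ps = map (\<lambda>(\<phi>, a). (\<phi>, star a * \<tau> (\<phi> h) a)) ps"

lemma prod_simps [simp]:
  "orbit_prod [] g = 1" "orbit_prod ((\<phi>, a) # ps) g = \<tau> (\<phi> g) a * orbit_prod ps g"
  "state_prod [] = 1" "state_prod ((\<phi>, a) # ps) = \<omega> a * state_prod ps"
  "correlate h [] = []" "correlate h ((\<phi>, a) # ps) = (\<phi>, star a * \<tau> (\<phi> h) a) # correlate h ps"
  by (simp_all add: orbit_prod_def state_prod_def correlate_def)

lemma map_fst_correlate: "map fst (correlate h ps) = map fst ps"
  by (induction ps) (auto simp: correlate_def)

lemma continuous_orbit_prod:
  "fst ` set ps \<subseteq> M \<Longrightarrow> continuous_on UNIV (orbit_prod ps)"
proof (induction ps)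
  case (Cons p ps)
  obtain \<phi> a where "p = (\<phi>, a)" by fastforce
  with Cons show ?case
    by (auto simp: orbit_prod_def intro!: continuous_on_mult continuous_orbit)
qed (simp add: orbit_prod_def)

lemma orbit_prod_bounded: "\<exists>B\<ge>0. \<forall>g. norm (orbit_prod ps g) \<le> B"
proof (induction ps)
  case (Cons p ps)
  then obtain B where B: "B \<ge> 0" "\<And>g. norm (orbit_prod ps g) \<le> B" by blast
  obtain \<phi> a where p: "p = (\<phi>, a)" by fastforce
  have "norm (orbit_prod (p # ps) g) \<le> (2 * norm a) * B" for g
  proof -
    have "norm (orbit_prod (p # ps) g) \<le> norm (\<tau> (\<phi> g) a) * norm (orbit_prod ps g)"
      by (simp add: p norm_mult_ineq)
    also have "\<dots> \<le> (2 * norm a) * B" by (intro mult_mono norm_action_le B) auto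
    finally show ?thesis .
  qed
  then show ?case using B(1) by (intro exI[of _ "(2 * norm a) * B"]) auto
qed (auto intro: exI[of _ 1])

text \<open>Factoring out the automorphism at \<psi> g leaves a commutator of \<open>e\<close> with
  the orbit of \<open>d\<close> under the difference of \<phi> and \<psi>, which lies in
  \<open>M\<close> by translationality.\<close>

lemma orbit_commutator_null:
  assumes "\<phi> \<in> M" "\<psi> \<in> M" "\<phi> \<noteq> \<psi>"
  shows "null_avg (\<lambda>g. norm (\<tau> (\<psi> g) e * \<tau> (\<phi> g) d - \<tau> (\<phi> g) d * \<tau> (\<psi> g) e))"
proof (rule null_avg_mono[OF null_avg_cmult[OF asymptotic_abelian_null[OF diff_mem[OF assms], of e d], of 2]])
  fix g
  have "\<tau> (\<phi> g) d = \<tau> (\<psi> g) (\<tau> (- \<psi> g + \<phi> g) d)" by (simp add: action_action)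
  then have "\<tau> (\<psi> g) e * \<tau> (\<phi> g) d - \<tau> (\<phi> g) d * \<tau> (\<psi> g) e
      = \<tau> (\<psi> g) (e * \<tau> (- \<psi> g + \<phi> g) d - \<tau> (- \<psi> g + \<phi> g) d * e)"
    by (simp only: action_mult action_diff)
  then show "norm (\<tau> (\<psi> g) e * \<tau> (\<phi> g) d - \<tau> (\<phi> g) d * \<tau> (\<psi> g) e)
      \<le> 2 * norm (e * \<tau> (- \<psi> g + \<phi> g) d - \<tau> (- \<psi> g + \<phi> g) d * e)"
    using norm_action_le by metis
qed (auto intro!: continuous_intros continuous_orbit assms)

text \<open>Induction by the Leibniz rule for commutators; the head factor appears last because the
  involution reverses the order.\<close>

lemma orbit_prod_commutator_null:
  assumes "\<phi> \<in> M"
  shows "fst ` set ps \<subseteq> M \<Longrightarrow> \<phi> \<notin> fst ` set ps \<Longrightarrow>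
    null_avg (\<lambda>g. norm (star (orbit_prod ps g) * \<tau> (\<phi> g) d - \<tau> (\<phi> g) d * star (orbit_prod ps g)))"
proof (induction ps)
  case Nil
  then show ?case by (simp add: star_one null_avg_zero)
next
  case (Cons p ps)
  obtain \<psi> e where p: "p = (\<psi>, e)" by fastforce
  with Cons have mem: "\<psi> \<in> M" "\<phi> \<noteq> \<psi>" "fst ` set ps \<subseteq> M" by auto
  obtain B where B: "B \<ge> 0" "\<And>g. norm (orbit_prod ps g) \<le> B" using orbit_prod_bounded by blast
  define X s D where "X = (\<lambda>g. star (orbit_prod ps g))" and "s = (\<lambda>g. \<tau> (\<psi> g) (star e))"
    and "D = (\<lambda>g. \<tau> (\<phi> g) d)"
  have "null_avg (\<lambda>g. norm (s g * D g - D g * s g))"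
    unfolding s_def D_def by (rule orbit_commutator_null[OF assms mem(1,2)])
  moreover have "null_avg (\<lambda>g. norm (X g * D g - D g * X g))"
    unfolding X_def D_def using Cons by auto
  ultimately have n: "null_avg (\<lambda>g. B * norm (s g * D g - D g * s g) + (2 * norm e) * norm (X g * D g - D g * X g))"
    using B by (intro null_avg_add null_avg_cmult) auto
  have eq: "star (orbit_prod (p # ps) g) = X g * s g" for g
    by (simp add: p X_def s_def star_mult action_star)
  have eqD: "\<tau> (\<phi> g) d = D g" for g by (simp add: D_def)
  show ?case unfolding eq eqD
  proof (rule null_avg_mono[OF n])
    show "continuous_on UNIV (\<lambda>g. norm (X g * s g * D g - D g * (X g * s g)))"
      unfolding X_def s_def D_def
      by (intro continuous_intros continuous_star continuous_orbit continuous_orbit_prod mem assms)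
    fix g
    have "X g * s g * D g - D g * (X g * s g) = X g * (s g * D g - D g * s g) + (X g * D g - D g * X g) * s g"
      by (simp add: algebra_simps)
    also have "norm \<dots> \<le> norm (X g) * norm (s g * D g - D g * s g) + norm (X g * D g - D g * X g) * norm (s g)"
      by (intro order_trans[OF norm_triangle_ineq] add_mono norm_mult_ineq)
    also have "\<dots> \<le> B * norm (s g * D g - D g * s g) + norm (X g * D g - D g * X g) * (2 * norm e)"
      using B(2)[of g] norm_action_le[of "\<psi> g" "star e"]
      by (intro add_mono mult_right_mono mult_left_mono) (auto simp: X_def s_def norm_star)
    finally show "norm (X g * s g * D g - D g * (X g * s g))
      \<le> B * norm (s g * D g - D g * s g) + (2 * norm e) * norm (X g * D g - D g * X g)"
      by (simp add: mult.commute)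
  qed simp
qed

text \<open>The two head factors meet in the middle of X D Y, merged into D. Moving D to the left
  past X costs a null commutator, and the remaining X Y is handled by induction.\<close>

lemma orbit_prod_correlate_null:
  "fst ` set ps \<subseteq> M \<Longrightarrow> distinct (map fst ps) \<Longrightarrow>
    null_avg (\<lambda>g. norm (star (orbit_prod ps g) * orbit_prod ps (g + h) - orbit_prod (correlate h ps) g))"
proof (induction ps)
  case Nil
  then show ?case by (simp add: star_one null_avg_zero)
next
  case (Cons p ps)
  obtain \<phi> a where p: "p = (\<phi>, a)" by fastforce
  with Cons have mem: "\<phi> \<in> M" "fst ` set ps \<subseteq> M" "\<phi> \<notin> fst ` set ps" by auto
  have memc: "fst ` set (correlate h ps) \<subseteq> M"
    using mem(2) by (metis map_fst_correlate list.set_map)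
  obtain B where B: "B \<ge> 0" "\<And>g. norm (orbit_prod ps g) \<le> B" using orbit_prod_bounded by blast
  define X Y Z D where "X = (\<lambda>g. star (orbit_prod ps g))" and "Y = (\<lambda>g. orbit_prod ps (g + h))"
    and "Z = orbit_prod (correlate h ps)" and "D = (\<lambda>g. \<tau> (\<phi> g) (star a * \<tau> (\<phi> h) a))"
  define A where "A = 2 * norm (star a * \<tau> (\<phi> h) a)"
  have "null_avg (\<lambda>g. norm (X g * D g - D g * X g))"
    unfolding X_def D_def by (rule orbit_prod_commutator_null[OF mem])
  moreover have "null_avg (\<lambda>g. norm (X g * Y g - Z g))"
    unfolding X_def Y_def Z_def using Cons by auto
  ultimately have n: "null_avg (\<lambda>g. B * norm (X g * D g - D g * X g) + A * norm (X g * Y g - Z g))"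
    using B by (intro null_avg_add null_avg_cmult) (auto simp: A_def)
  have eq: "star (orbit_prod (p # ps) g) * orbit_prod (p # ps) (g + h) = X g * D g * Y g" for g
    by (simp add: p X_def Y_def D_def star_mult action_star action_mult action_action hom_add mem mult.assoc)
  have eq2: "orbit_prod (correlate h (p # ps)) g = D g * Z g" for g
    by (simp add: p D_def Z_def)
  show ?case unfolding eq eq2
  proof (rule null_avg_mono[OF n])
    have "continuous_on UNIV X" "continuous_on UNIV Y" "continuous_on UNIV Z" "continuous_on UNIV D"
      unfolding X_def Y_def Z_def D_def
      by (rule continuous_star continuous_orbit_prod continuous_orbit mem memc
          continuous_on_compose2[OF continuous_orbit_prod[OF mem(2)] _ subset_UNIV] continuous_intros)+
    then show "continuous_on UNIV (\<lambda>g. norm (X g * D g * Y g - D g * Z g))"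
      by (intro continuous_intros)
    fix g
    have "X g * D g * Y g - D g * Z g = (X g * D g - D g * X g) * Y g + D g * (X g * Y g - Z g)"
      by (simp add: algebra_simps)
    also have "norm \<dots> \<le> norm (X g * D g - D g * X g) * norm (Y g) + norm (D g) * norm (X g * Y g - Z g)"
      by (intro order_trans[OF norm_triangle_ineq] add_mono norm_mult_ineq)
    also have "\<dots> \<le> norm (X g * D g - D g * X g) * B + A * norm (X g * Y g - Z g)"
      unfolding Y_def D_def A_def
      by (intro add_mono mult_right_mono mult_left_mono B norm_action_le) auto
    finally show "norm (X g * D g * Y g - D g * Z g) \<le> B * norm (X g * D g - D g * X g) + A * norm (X g * Y g - Z g)"
      by (simp add: mult.commute)
  qed simp
qed

lemma state_prod_correlate_bounded:
  "fst ` set ps \<subseteq> M \<Longrightarrow>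
   continuous_on UNIV (\<lambda>h. state_prod (correlate h ps)) \<and> (\<exists>B\<ge>0. \<forall>h. cmod (state_prod (correlate h ps)) \<le> B)"
proof (induction ps)
  case (Cons p ps)
  then obtain B where B: "B \<ge> 0" "\<And>h. cmod (state_prod (correlate h ps)) \<le> B" by auto
  obtain \<phi> a where p: "p = (\<phi>, a)" by fastforce
  define A where "A = 2 * (norm a * (2 * norm a))"
  have "cmod (\<omega> (star a * \<tau> (\<phi> h) a)) \<le> A" for h
    using state_norm_le[of "star a * \<tau> (\<phi> h) a"] norm_mult_ineq[of "star a" "\<tau> (\<phi> h) a"]
      mult_left_mono[OF norm_action_le[of "\<phi> h" a], of "norm a"] by (simp add: A_def norm_star)
  then have "cmod (state_prod (correlate h (p # ps))) \<le> A * B" for h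
    by (simp add: p norm_mult) (intro mult_mono B, auto simp: A_def)
  moreover have "0 \<le> A * B" using B by (simp add: A_def)
  moreover have "continuous_on UNIV (\<lambda>h. state_prod (correlate h (p # ps)))"
    using Cons p by (auto intro!: continuous_intros continuous_state continuous_orbit)
  ultimately show ?case by blast
qed (auto intro: exI[of _ 1])

text \<open>By weak mixing in the shift \<open>h\<close>, each factor approaches \<omega> (star a) *
  \<omega> a in the averaged sense. Boundedness of the other factors lets the product
  telescope.\<close>

lemma state_prod_correlate_null:
  "fst ` set ps \<subseteq> M \<Longrightarrow>
    null_avg (\<lambda>h. cmod (state_prod (correlate h ps) - cnj (state_prod ps) * state_prod ps))"
proof (induction ps)
  case Nil
  then show ?case by (simp add: null_avg_zero)
next
  case (Cons p ps)
  obtain \<phi> a where p: "p = (\<phi>, a)" by fastforce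
  with Cons have mem: "\<phi> \<in> M" "fst ` set ps \<subseteq> M" by auto
  obtain B where B: "B \<ge> 0" "\<And>h. cmod (state_prod (correlate h ps)) \<le> B"
    using state_prod_correlate_bounded[OF mem(2)] by auto
  define x y x0 y0 where "x = (\<lambda>h. \<omega> (star a * \<tau> (\<phi> h) a))" and "y = (\<lambda>h. state_prod (correlate h ps))"
    and "x0 = \<omega> (star a) * \<omega> a" and "y0 = cnj (state_prod ps) * state_prod ps"
  have n: "null_avg (\<lambda>h. B * cmod (x h - x0) + cmod x0 * cmod (y h - y0))"
    unfolding x_def y_def x0_def y0_def
    by (intro null_avg_add null_avg_cmult weak_mixing_null mem Cons.IH B) auto
  have eq: "state_prod (correlate h (p # ps)) - cnj (state_prod (p # ps)) * state_prod (p # ps) = x h * y h - x0 * y0" for h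
    by (simp add: p x_def y_def x0_def y0_def state_star mult_ac)
  have le: "cmod (x h * y h - x0 * y0) \<le> B * cmod (x h - x0) + cmod x0 * cmod (y h - y0)" for h
  proof -
    have "x h * y h - x0 * y0 = y h * (x h - x0) + x0 * (y h - y0)" by (simp add: algebra_simps)
    also have "cmod \<dots> \<le> cmod (y h) * cmod (x h - x0) + cmod x0 * cmod (y h - y0)"
      by (metis norm_triangle_ineq norm_mult)
    also have "\<dots> \<le> B * cmod (x h - x0) + cmod x0 * cmod (y h - y0)"
      by (intro add_mono mult_right_mono) (auto simp: y_def B)
    finally show ?thesis .
  qed
  have "continuous_on UNIV x" "continuous_on UNIV y"
    using state_prod_correlate_bounded[OF mem(2)] unfolding x_def y_def
    by (auto intro!: continuous_state continuous_on_mult continuous_on_const continuous_orbit mem)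
  then show ?case unfolding eq
    by (intro null_avg_mono[OF n _ _ le] continuous_intros) auto
qed

section \<open>Induction on the number of homomorphisms\<close>

lemma orbit_prod_shift:
  "\<tau> (\<phi> g) (orbit_prod (map (\<lambda>(\<psi>, b). (\<lambda>g. - \<phi> g + \<psi> g, b)) ps) g) = orbit_prod ps g"
  by (induction ps) (auto simp: action_one action_mult action_action)

text \<open>Invariance of the state removes the automorphism at \<phi> g: the head becomes a
  constant left factor, and the other homomorphisms become differences with \<phi>. These stay
  distinct and in \<open>M\<close>, and there is one fewer.\<close>

lemma mean_convergence_step:
  assumes mem: "fst ` set ((\<phi>, a) # ps) \<subseteq> M" and dist: "distinct (map fst ((\<phi>, a) # ps))"
    and IH: "\<And>qs a0. length qs = length ps \<Longrightarrow> fst ` set qs \<subseteq> M \<Longrightarrow> distinct (map fst qs) \<Longrightarrow>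
      null_avg (\<lambda>g. cmod (\<omega> (a0 * orbit_prod qs g) - \<omega> a0 * state_prod qs))"
  shows "null_avg (\<lambda>g. cmod (\<omega> (orbit_prod ((\<phi>, a) # ps) g) - state_prod ((\<phi>, a) # ps)))"
proof -
  define qs where "qs = map (\<lambda>(\<psi>, b). (\<lambda>g. - \<phi> g + \<psi> g, b)) ps"
  have fst_qs: "map fst qs = map (\<lambda>\<psi> g. - \<phi> g + \<psi> g) (map fst ps)"
    by (auto simp: qs_def)
  have "inj (\<lambda>\<psi> g. - \<phi> g + \<psi> g)" by (rule injI) (auto simp: fun_eq_iff)
  then have "distinct (map fst qs)"
    using dist unfolding fst_qs by (subst distinct_map) (auto intro: inj_on_subset)
  moreover have "fst ` set qs = (\<lambda>\<psi> g. - \<phi> g + \<psi> g) ` fst ` set ps"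
    using fst_qs by (metis list.set_map)
  then have "fst ` set qs \<subseteq> M"
    using mem dist by (auto intro!: diff_mem simp del: uminus_add_conv_diff)
  ultimately have "null_avg (\<lambda>g. cmod (\<omega> (a * orbit_prod qs g) - \<omega> a * state_prod qs))"
    by (intro IH) (simp_all add: qs_def)
  moreover have "\<omega> (orbit_prod ((\<phi>, a) # ps) g) = \<omega> (a * orbit_prod qs g)" for g
  proof -
    have "orbit_prod ((\<phi>, a) # ps) g = \<tau> (\<phi> g) (a * orbit_prod qs g)"
      unfolding qs_def action_mult orbit_prod_shift by simp
    then show ?thesis by (simp only: state_action)
  qed
  moreover have "state_prod qs = state_prod ps"
    unfolding qs_def by (induction ps) auto
  ultimately show ?thesis by simp
qed

text \<open>Restores the left factor by applying van der Corput's argument to the square of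
  |\<omega> (a * v_g)|. Assumption \<open>R\<close> ranges over all lists with the same
  homomorphisms because it is used both for \<open>ps\<close> and for its correlated lists.\<close>

lemma correlation_step:
  assumes mem: "fst ` set ps \<subseteq> M" and dist: "distinct (map fst ps)"
    and R: "\<And>qs. map fst qs = map fst ps \<Longrightarrow> null_avg (\<lambda>g. cmod (\<omega> (orbit_prod qs g) - state_prod qs))"
  shows "null_avg (\<lambda>g. cmod (\<omega> (a * orbit_prod ps g) - \<omega> a * state_prod ps))"
proof -
  define U c where "U = orbit_prod ps" and "c = state_prod ps"
  define v where "v = (\<lambda>g. U g - cscale j c 1)"
  define F where "F = (\<lambda>g. cmod (\<omega> (a * v g)))"
  define W where "W = (\<lambda>h. orbit_prod (correlate h ps))"
  define \<gamma> where "\<gamma> = (\<lambda>h. cmod (state_prod (correlate h ps) - cnj c * c))"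
  \<comment> \<open>The errors in order: rearranging the product, replacing its expectation by the
    product of states, and two terms from centring by \<open>c\<close>. The factor 2 is the bound on
    the state.\<close>
  define E where "E = (\<lambda>h g. 2 * norm (star (U g) * U (g + h) - W h g)
    + cmod (\<omega> (W h g) - state_prod (correlate h ps))
    + cmod c * cmod (\<omega> (U g) - c) + cmod c * cmod (\<omega> (U (g + h)) - c))"
  have Fv: "\<omega> (a * v g) = \<omega> (a * U g) - \<omega> a * c" for g
    by (simp add: v_def right_diff_distrib mult_cscale state_diff state_cscale)
  obtain B0 where B0: "B0 \<ge> 0" "\<And>g. norm (U g) \<le> B0" using orbit_prod_bounded unfolding U_def by blast
  define b where "b = B0 + cmod c"
  have vb: "norm (v g) \<le> b" for g
    using norm_triangle_ineq4[of "U g" "cscale j c 1"] B0(2)[of g] by (simp add: v_def norm_cscale b_def)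
  have b: "0 \<le> b" using B0 by (simp add: b_def)
  have Fb: "F g \<le> 2 * (norm a * b)" for g
    using state_norm_le[of "a * v g"] norm_mult_ineq[of a "v g"] mult_left_mono[OF vb[of g], of "norm a"]
    by (simp add: F_def)
  have Fc: "continuous_on UNIV F"
    unfolding F_def Fv unfolding U_def
    by (intro continuous_intros continuous_state continuous_orbit_prod[OF mem])
  have F: "bdd_cont F" using Fc Fb by (intro bdd_contI) (auto simp: F_def)
  have "\<bar>(F g)\<^sup>2\<bar> \<le> (2 * (norm a * b))\<^sup>2" for g
    using power_mono[OF Fb[of g], of 2] by (simp add: F_def)
  then have F2: "bdd_cont (\<lambda>g. (F g)\<^sup>2)" using Fc by (intro bdd_contI continuous_intros) auto
  have \<gamma>: "null_avg \<gamma>" unfolding \<gamma>_def c_def by (rule state_prod_correlate_null[OF mem])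
  have RU: "null_avg (\<lambda>g. cmod (\<omega> (U g) - c))" unfolding U_def c_def by (rule R) simp
  have E: "null_avg (E h)" for h
    unfolding E_def
    by (intro null_avg_add null_avg_cmult RU null_avg_translate[OF RU])
       (auto simp: U_def W_def intro!: orbit_prod_correlate_null mem dist R map_fst_correlate)
  have K: "cmod (\<omega> (star (v g) * v (g + h))) \<le> \<gamma> h + E h g" for g h
  proof -
    have "\<omega> (star (v g) * v (g + h)) = \<omega> (star (U g) * U (g + h)) - c * \<omega> (star (U g)) - cnj c * \<omega> (U (g + h)) + cnj c * c"
      by (simp add: v_def star_diff star_cscale star_one left_diff_distrib right_diff_distrib mult_cscale
          state_diff state_cscale state_one)
    also have "\<dots> = (state_prod (correlate h ps) - cnj c * c)
        + (\<omega> (star (U g) * U (g + h) - W h g)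
        + (\<omega> (W h g) - state_prod (correlate h ps))
        - c * cnj (\<omega> (U g) - c) - cnj c * (\<omega> (U (g + h)) - c))"
      by (simp add: state_diff state_star algebra_simps)
    also have "cmod \<dots> \<le> cmod (state_prod (correlate h ps) - cnj c * c)
        + (cmod (\<omega> (star (U g) * U (g + h) - W h g))
        + cmod (\<omega> (W h g) - state_prod (correlate h ps))
        + cmod (c * cnj (\<omega> (U g) - c)) + cmod (cnj c * (\<omega> (U (g + h)) - c)))"
      by (intro norm_triangle_mono norm_triangle_le_diff add_mono order_refl)
    also have "\<dots> \<le> \<gamma> h + E h g"
      using state_norm_le[of "star (U g) * U (g + h) - W h g"]
      by (simp add: \<gamma>_def E_def norm_mult del: complex_cnj_diff)
    finally show ?thesis .
  qed
  define q B where "q = Re (\<omega> (a * star a))" and "B = 2 * b\<^sup>2"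
  have q: "0 \<le> q" using state_positive(2)[of "star a"] by (simp add: q_def star_star)
  have B: "0 \<le> B" by (simp add: B_def)
  have vB: "Re (\<omega> (star (v g) * v g)) \<le> B" for g
    using order_trans[OF complex_Re_le_cmod state_norm_le[of "star (v g) * v g"]] power_mono[OF vb[of g], of 2]
    by (simp add: norm_star_mult_self B_def)
  have "null_avg (\<lambda>g. (F g)\<^sup>2)"
  proof (rule van_der_Corput[OF F2 _ _ \<gamma> E])
    \<comment> \<open>One constant must serve both as additive term and as multiplier; since S \<ge>
      0, B + 2 * S is at most (B + 2) + (B + 2) * S.\<close>
    show "0 \<le> q * (B + 2)" using q B by simp
    fix N :: nat and h :: "nat \<Rightarrow> 'g" and g
    define S where "S = (\<Sum>k<N. \<Sum>i<k. \<gamma> (h k - h i) + E (h k - h i) (g + h i))"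
    have "(\<Sum>k<N. \<Sum>i<k. cmod (\<omega> (star (v (g + h i)) * v (g + h k)))) \<le> S"
      unfolding S_def
    proof (intro sum_mono)
      fix k i
      show "cmod (\<omega> (star (v (g + h i)) * v (g + h k))) \<le> \<gamma> (h k - h i) + E (h k - h i) (g + h i)"
        using K[of "g + h i" "h k - h i"] by simp
    qed
    then have "q * (B + 2 * (\<Sum>k<N. \<Sum>i<k. cmod (\<omega> (star (v (g + h i)) * v (g + h k))))) \<le> q * (B + 2 * S)"
      by (intro mult_left_mono q) auto
    then have "(\<Sum>i<N. (F (g + h i))\<^sup>2) \<le> q * (B + 2 * S)"
      using state_Boas_Bellman[OF B, where x="\<lambda>i. v (g + h i)" and a=a and N=N] vB
      unfolding F_def q_def by (meson order_trans)
    also have "\<dots> \<le> q * ((B + 2) + (B + 2) * S)"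
    proof (intro mult_left_mono q add_mono mult_right_mono)
      show "0 \<le> S" unfolding S_def
        by (intro sum_nonneg add_nonneg_nonneg null_avgD(2)[OF \<gamma>] null_avgD(2)[OF E])
    qed (use B in auto)
    finally show "(\<Sum>i<N. (F (g + h i))\<^sup>2) \<le> q * (B + 2) + q * (B + 2)
        * (\<Sum>k<N. \<Sum>i<k. \<gamma> (h k - h i) + E (h k - h i) (g + h i))"
      by (simp add: S_def algebra_simps)
  qed simp
  then have "null_avg F" by (rule null_avg_power2D[OF _ F]) (simp add: F_def)
  then show ?thesis by (simp add: F_def Fv U_def c_def)
qed

text \<open>One induction step combines both reductions: first the left factor is dropped, then the
  list is shortened at the price of a new left factor. Hence \<open>a\<close> must vary in the
  induction.\<close>

theorem mixing_of_all_orders: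
  "fst ` set ps \<subseteq> M \<Longrightarrow> distinct (map fst ps) \<Longrightarrow>
    null_avg (\<lambda>g. cmod (\<omega> (a * orbit_prod ps g) - \<omega> a * state_prod ps))"
proof (induction "length ps" arbitrary: ps a)
  case 0
  then show ?case by (simp add: null_avg_zero)
next
  case (Suc n)
  show ?case
  proof (rule correlation_step[OF Suc.prems])
    fix qs :: "(('g \<Rightarrow> 'g) \<times> 'a) list" assume eq: "map fst qs = map fst ps"
    then have len: "length qs = Suc n" using Suc.hyps(2) by (metis length_map)
    then obtain \<phi> b rs where qs: "qs = (\<phi>, b) # rs" by (cases qs) auto
    have mem: "fst ` set qs \<subseteq> M" using eq Suc.prems(1) by (metis list.set_map)
    show "null_avg (\<lambda>g. cmod (\<omega> (orbit_prod qs g) - state_prod qs))"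
      unfolding qs using mem eq Suc.prems(2) len Suc.hyps(1)
      by (intro mean_convergence_step) (simp_all flip: qs, simp_all add: qs)
  qed
qed

end

theorem theorem4p6:
  fixes \<mu> :: "'g::{topological_ab_group_add, t2_space, second_countable_topology} measure"
    and \<Lambda> :: "nat \<Rightarrow> 'g set"
    and M :: "('g \<Rightarrow> 'g) set"
    and j :: "'a::{real_normed_algebra_1, banach}"
    and star :: "'a \<Rightarrow> 'a"
    and \<omega> :: "'a \<Rightarrow> complex"
    and \<tau> :: "'g \<Rightarrow> 'a \<Rightarrow> 'a"
  assumes lc: "locally_compact_space (euclidean :: 'g topology)"
    and haar: "haar_measure \<mu>"
    and folner: "folner_seq \<mu> \<Lambda>"
    and temp: "tempelman \<mu> \<Lambda>"
    and folner2: "folner_seq \<mu> (\<lambda>n. inv_mult_set (\<Lambda> n) (\<Lambda> n))"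
    and hom: "\<forall>\<phi> \<in> M. group_hom \<phi>"
    and trans: "translational M"
    and sys: "cstar_dyn_system j star \<omega> \<tau>"
    and meas: "M_measurable \<omega> \<tau> M"
    and wm: "M_weakly_mixing \<mu> \<omega> \<tau> M \<Lambda>"
    and aa: "M_asymptotically_abelian \<mu> \<tau> M \<Lambda>"
    and cont: "\<forall>\<phi> \<in> M. \<forall>a. continuous_on UNIV (\<lambda>g. \<tau> (\<phi> g) a)"
  shows "\<forall>(k::nat) (a::nat \<Rightarrow> 'a) (\<phi>::nat \<Rightarrow> 'g \<Rightarrow> 'g).
           (\<forall>i \<in> {1..k}. \<phi> i \<in> M) \<longrightarrow> inj_on \<phi> {1..k} \<longrightarrow> \<phi> 0 = (\<lambda>g. 0) \<longrightarrow>
           (\<lambda>n. favg \<mu> (\<Lambda> n)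
              (\<lambda>g. cmod (\<omega> (prod_list (map (\<lambda>i. \<tau> (\<phi> i g) (a i)) [0..<Suc k]))
                          - (\<Prod>i\<le>k. \<omega> (a i))))) \<longlonglongrightarrow> 0"
proof (intro allI impI)
  fix k :: nat and a :: "nat \<Rightarrow> 'a" and \<phi> :: "nat \<Rightarrow> 'g \<Rightarrow> 'g"
  assume M: "\<forall>i \<in> {1..k}. \<phi> i \<in> M" and inj: "inj_on \<phi> {1..k}" and \<phi>0: "\<phi> 0 = (\<lambda>g. 0)"
  interpret mixing_system j star \<omega> \<mu> \<Lambda> M \<tau>
    by unfold_locales (use assms in \<open>auto simp: cstar_dyn_system_def\<close>)
  \<comment> \<open>Index 0 is left out: \<phi> 0 is trivial, so \<open>a 0\<close> becomes the
    constant left factor and only homomorphisms from \<open>M\<close> enter the list.\<close>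
  define ps where "ps = map (\<lambda>i. (\<phi> i, a i)) [1..<Suc k]"
  have set: "set [1..<Suc k] = {1..k}" by auto
  have upt: "[0..<Suc k] = 0 # [1..<Suc k]" by (simp add: upt_conv_Cons)
  have "fst ` set ps \<subseteq> M" unfolding ps_def set_map set using M by auto
  moreover have "map fst ps = map \<phi> [1..<Suc k]" by (simp add: ps_def comp_def)
  then have "distinct (map fst ps)" using inj set by (simp only: distinct_map) simp
  ultimately have lim: "(\<lambda>n. favg \<mu> (\<Lambda> n) (\<lambda>g. cmod (\<omega> (a 0 * orbit_prod ps g) - \<omega> (a 0) * state_prod ps)))
      \<longlonglongrightarrow> 0"
    by (intro null_avgD(3) mixing_of_all_orders)
  have "\<tau> 0 = id" using sys by (simp add: cstar_dyn_system_def)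
  then have "prod_list (map (\<lambda>i. \<tau> (\<phi> i g) (a i)) [0..<Suc k]) = a 0 * orbit_prod ps g" for g
    unfolding upt by (simp only: list.map prod_list.Cons \<phi>0 id_apply) (simp add: orbit_prod_def ps_def comp_def)
  moreover have "(\<Prod>i\<le>k. \<omega> (a i)) = (\<Prod>i\<in>set [0..<Suc k]. \<omega> (a i))"
    by (rule prod.cong) auto
  then have "(\<Prod>i\<le>k. \<omega> (a i)) = prod_list (map (\<lambda>i. \<omega> (a i)) [0..<Suc k])"
    by (simp only: prod.distinct_set_conv_list[OF distinct_upt])
  then have "(\<Prod>i\<le>k. \<omega> (a i)) = \<omega> (a 0) * state_prod ps"
    unfolding upt by (simp only: list.map prod_list.Cons) (simp add: state_prod_def ps_def comp_def)
  ultimately show "(\<lambda>n. favg \<mu> (\<Lambda> n)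
      (\<lambda>g. cmod (\<omega> (prod_list (map (\<lambda>i. \<tau> (\<phi> i g) (a i)) [0..<Suc k])) - (\<Prod>i\<le>k. \<omega> (a i)))))
      \<longlonglongrightarrow> 0"
    using lim by (simp only:)
qed

end
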